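(* Let $w$ be a bi-infinite word over a finite alphabet, and let $p$ be the complexity function associated to $w$. Assume that there is a constant $C$ such that $p(n)\le Cn$ for all $n$ big enough. Then the first rational (Čech) cohomology group of the suspension space $\Omega_w$ associated to $w$ is finitely generated over $\mathbb{Q}$.
   Context: $p(n)$ is the number of distinct subwords (factors) of length $n$ of $w$. Let $\mathcal{A}$ be the alphabet, $\mathcal{A}^{\mathbb{Z}}$ with the product topology and the shift $\tau(x)_i=x_{i+1}$. $\Theta_w$ is the closure in $\mathcal{A}^{\mathbb{Z}}$ of $\{\tau^n(w): n\in\mathbb{Z}\}$. The suspension is $\Omega_w=\Theta_w\times\mathbb{R}/\sim$, where $\sim$ is generated by $(x,t)\sim(\tau(x),t-1)$; a basis of open sets is given by $U(V,I)=\{[(x,t)]: x\in V,\ t\in I\}$ with $V\subseteq\Theta_w$ open and $I\subseteq\mathbb{R}$ an open interval. *)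

theory Defs
  imports "HOL-Analysis.Analysis" "Jordan_Normal_Form.VS_Connect"
begin

section \<open>Bi-infinite words, orbit closures and suspensions\<close>

definition complexity :: "(int \<Rightarrow> 'a) \<Rightarrow> nat \<Rightarrow> nat" where
  "complexity w n = card {map (\<lambda>k. w (i + int k)) [0..<n] | i. True}"

text \<open>\<open>shift n\<close> is the \<open>n\<close>-th iterate of the shift map \<open>shift 1\<close>, for \<open>n\<close> of either sign.\<close>

definition shift :: "int \<Rightarrow> (int \<Rightarrow> 'a) \<Rightarrow> (int \<Rightarrow> 'a)" where
  "shift n x = (\<lambda>i. x (i + n))"

definition full_shift :: "'a set \<Rightarrow> (int \<Rightarrow> 'a) topology" where
  "full_shift A = product_topology (\<lambda>_. discrete_topology A) UNIV"

definition orbit_closure :: "'a set \<Rightarrow> (int \<Rightarrow> 'a) \<Rightarrow> (int \<Rightarrow> 'a) set" where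
  "orbit_closure A w = full_shift A closure_of {shift n w | n. True}"

definition suspension_rel :: "(int \<Rightarrow> 'a) set \<Rightarrow> (((int \<Rightarrow> 'a) \<times> real) \<times> ((int \<Rightarrow> 'a) \<times> real)) set" where
  "suspension_rel T = (let r = {((x, t), (shift 1 x, t - 1)) | x t. x \<in> T} in (r \<union> r\<inverse>)\<^sup>*)"

text \<open>The points of the suspension are the equivalence classes in \<open>orbit_closure A w \<times> \<real>\<close>
  (see \<open>topspace_suspension\<close>); it carries the quotient topology
  (see \<open>quotient_map_suspension\<close>).\<close>

definition suspension :: "'a set \<Rightarrow> (int \<Rightarrow> 'a) \<Rightarrow> ((int \<Rightarrow> 'a) \<times> real) set topology" where
  "suspension A w = topology_generated_by
     {{suspension_rel (orbit_closure A w) `` {(x, t)} | x t. x \<in> V \<and> t \<in> {a<..<b}} | V a b.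
        openin (subtopology (full_shift A) (orbit_closure A w)) V}"


section \<open>The topology of the suspension\<close>

lemma topspace_full_shift: "topspace (full_shift A) = {x. range x \<subseteq> A}"
  by (auto simp: full_shift_def PiE_UNIV_domain)

lemma shift_0 [simp]: "shift 0 x = x"
  by (simp add: shift_def)

lemma shift_shift [simp]: "shift m (shift n x) = shift (m + n) x"
  by (simp add: shift_def add_ac)

lemma continuous_map_shift: "continuous_map (full_shift A) (full_shift A) (shift n)"
  unfolding full_shift_def continuous_map_componentwise_UNIV
  by (auto simp: shift_def intro: continuous_map_product_projection)

lemma shift_orbit_closure:
  assumes "x \<in> orbit_closure A w"
  shows "shift n x \<in> orbit_closure A w"
proof -
  have "shift n ` {shift k w | k. True} \<subseteq> {shift k w | k. True}" by auto
  hence "full_shift A closure_of (shift n ` {shift k w | k. True}) \<subseteq> orbit_closure A w"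
    unfolding orbit_closure_def by (rule closure_of_mono)
  thus ?thesis
    using continuous_map_image_closure_subset[OF continuous_map_shift, of n A "{shift k w | k. True}"]
      assms unfolding orbit_closure_def by blast
qed

lemma suspension_rel_iff:
  assumes "\<And>y n. y \<in> T \<Longrightarrow> shift n y \<in> T" "x \<in> T"
  shows "((x, t), q) \<in> suspension_rel T \<longleftrightarrow> (\<exists>n. q = (shift n x, t - of_int n))"
proof -
  define r where "r = {((x, t), (shift 1 x, t - 1)) | x (t::real). x \<in> T}"
  have R: "suspension_rel T = (r \<union> r\<inverse>)\<^sup>*" by (simp add: suspension_rel_def r_def Let_def)
  have "\<exists>n. q = (shift n x, t - of_int n)" if "((x, t), q) \<in> (r \<union> r\<inverse>)\<^sup>*"
    using that
  proof (induction rule: rtrancl_induct)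
    case base
    show ?case by (intro exI[of _ 0]) simp
  next
    case (step y z)
    then obtain n where y: "y = (shift n x, t - of_int n)" by blast
    from step.hyps(2) show ?case
    proof
      assume "(y, z) \<in> r"
      thus ?thesis by (intro exI[of _ "n + 1"]) (auto simp: y r_def add.commute)
    next
      assume "(y, z) \<in> r\<inverse>"
      then obtain u s where z: "z = (u, s)" and u: "shift 1 u = shift n x" "s - 1 = t - of_int n"
        by (auto simp: y r_def)
      have "u = shift (-1) (shift 1 u)" by simp
      also have "\<dots> = shift (n - 1) x" by (simp add: u del: shift_shift) simp
      finally show ?thesis using u z by (intro exI[of _ "n - 1"]) auto
    qed
  qed
  moreover have "((x, t), (shift n x, t - of_int n)) \<in> (r \<union> r\<inverse>)\<^sup>*" for n
  proof (induction n rule: int_induct[where k = 0])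
    case base
    show ?case by simp
  next
    case (step1 i)
    have "((shift i x, t - of_int i), (shift (i + 1) x, t - of_int (i + 1))) \<in> r"
      using assms by (auto simp: r_def add.commute intro!: exI[of _ "shift i x"])
    thus ?case using step1 by (meson UnI1 rtrancl.rtrancl_into_rtrancl)
  next
    case (step2 i)
    have "((shift (i - 1) x, t - of_int (i - 1)), (shift i x, t - of_int i)) \<in> r"
      using assms by (auto simp: r_def intro!: exI[of _ "shift (i - 1) x"])
    thus ?case using step2 by (meson UnI2 converseI rtrancl.rtrancl_into_rtrancl)
  qed
  ultimately show ?thesis unfolding R by blast
qed

lemma equiv_suspension_rel: "equiv UNIV (suspension_rel T)"
  unfolding suspension_rel_def Let_def
  by (intro equivI refl_rtrancl sym_rtrancl trans_rtrancl) (auto simp: sym_def)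

lemma topspace_suspension:
  "topspace (suspension A w) = (orbit_closure A w \<times> UNIV) // suspension_rel (orbit_closure A w)"
proof -
  let ?T = "orbit_closure A w"
  have T: "?T \<subseteq> topspace (full_shift A)"
    unfolding orbit_closure_def by (rule closure_of_subset_topspace)
  show ?thesis (is "_ = ?Q")
  proof (intro equalityI subsetI)
    fix c assume "c \<in> topspace (suspension A w)"
    thus "c \<in> ?Q"
      by (auto simp: suspension_def openin_subtopology intro!: quotientI)
  next
    fix c assume "c \<in> ?Q"
    then obtain x t where c: "c = suspension_rel ?T `` {(x, t)}" "x \<in> ?T"
      by (auto elim!: quotientE)
    have "openin (subtopology (full_shift A) ?T) ?T"
      using T by (simp add: openin_subtopology_refl)
    moreover have "t \<in> {t - 1<..<t + 1}" by simp
    ultimately show "c \<in> topspace (suspension A w)"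
      unfolding suspension_def topology_generated_by_topspace using c by blast
  qed
qed

lemma quotient_map_suspension:
  "quotient_map (prod_topology (subtopology (full_shift A) (orbit_closure A w)) euclideanreal)
     (suspension A w) (\<lambda>p. suspension_rel (orbit_closure A w) `` {p})"
proof -
  let ?T = "orbit_closure A w" and ?R = "suspension_rel (orbit_closure A w)"
  let ?X = "subtopology (full_shift A) ?T"
  let ?P = "prod_topology ?X euclideanreal"
  define q where "q = (\<lambda>p. ?R `` {p})"
  have "?T \<subseteq> topspace (full_shift A)"
    unfolding orbit_closure_def by (rule closure_of_subset_topspace)
  hence tX: "topspace ?X = ?T" by auto
  have U: "{?R `` {(x, t)} | x t. x \<in> V \<and> t \<in> {a<..<b}} = q ` (V \<times> {a<..<b})" for V a b
    by (auto simp: q_def image_iff) blast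
  have S: "suspension A w
      = topology_generated_by {q ` (V \<times> {a<..<b}) | V a b. openin ?X V}"
    unfolding suspension_def U ..
  have qeq: "q (x, t) = q (y, s) \<longleftrightarrow> (\<exists>n. (y, s) = (shift n x, t - of_int n))"
    if "x \<in> ?T" for x y t s
    unfolding q_def eq_equiv_class_iff[OF equiv_suspension_rel UNIV_I UNIV_I]
    by (rule suspension_rel_iff[OF shift_orbit_closure that])
  have qtop: "q ` topspace ?P = topspace (suspension A w)"
    unfolding topspace_suspension q_def quotient_def using tX by auto
  have "continuous_map ?P (suspension A w) q" unfolding S
  proof (rule continuous_on_generated_topo)
    fix B assume "B \<in> {q ` (V \<times> {a<..<b}) | V a b. openin ?X V}"
    then obtain V a b where B: "B = q ` (V \<times> {a<..<b})" and V: "openin ?X V" by blast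
    have VT: "V \<subseteq> ?T" using openin_subset[OF V] tX by simp
    define W where "W n = {p \<in> topspace ?P. (shift n (fst p), snd p - of_int n) \<in> V \<times> {a<..<b}}" for n
    have "openin ?P (W n)" for n
    proof -
      have "continuous_map ?X ?X (shift n)"
        using shift_orbit_closure by (auto simp: continuous_map_in_subtopology
            intro!: continuous_map_from_subtopology continuous_map_shift)
      hence "continuous_map ?P ?X (\<lambda>p. shift n (fst p))"
        using continuous_map_compose[OF continuous_map_fst, of ?X ?X "shift n" euclideanreal]
        by (simp add: o_def)
      moreover have "continuous_map ?P euclideanreal (\<lambda>p. snd p - of_int n)"
        by (intro continuous_map_diff continuous_map_snd) auto
      ultimately have "continuous_map ?P ?P (\<lambda>p. (shift n (fst p), snd p - of_int n))"
        by (simp add: continuous_map_pairedI)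
      moreover have "openin ?P (V \<times> {a<..<b})"
        using V by (auto simp: openin_prod_Times_iff)
      ultimately show ?thesis unfolding W_def by (rule openin_continuous_map_preimage)
    qed
    moreover have "q -` B \<inter> topspace ?P = (\<Union>n. W n)"
    proof (intro equalityI subsetI)
      fix p assume p: "p \<in> q -` B \<inter> topspace ?P"
      obtain x t where [simp]: "p = (x, t)" by (cases p)
      have "x \<in> ?T" using p tX by simp
      have "q (x, t) \<in> q ` (V \<times> {a<..<b})" using p B by simp
      then obtain z where z: "q (x, t) = q z" "z \<in> V \<times> {a<..<b}" by (rule imageE)
      have "q (x, t) = q (fst z, snd z)" using z(1) by simp
      then obtain n where "z = (shift n x, t - of_int n)"
        unfolding qeq[OF \<open>x \<in> ?T\<close>] by auto
      thus "p \<in> (\<Union>n. W n)" using z(2) p by (auto simp: W_def)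
    next
      fix p assume "p \<in> (\<Union>n. W n)"
      then obtain n where n: "p \<in> W n" by blast
      obtain x t where [simp]: "p = (x, t)" by (cases p)
      have "x \<in> ?T" using n tX by (simp add: W_def)
      hence eq: "q (x, t) = q (shift n x, t - of_int n)" unfolding qeq[OF \<open>x \<in> ?T\<close>] by blast
      have "(shift n x, t - of_int n) \<in> V \<times> {a<..<b}" using n by (simp add: W_def)
      hence "q (shift n x, t - of_int n) \<in> B" unfolding B by (rule imageI)
      hence "q p \<in> B" unfolding \<open>p = (x, t)\<close> eq .
      moreover have "p \<in> topspace ?P" using n by (simp add: W_def)
      ultimately show "p \<in> q -` B \<inter> topspace ?P" by simp
    qed
    ultimately show "openin ?P (q -` B \<inter> topspace ?P)" by auto
  next
    show "q ` topspace ?P \<subseteq> \<Union>{q ` (V \<times> {a<..<b}) | V a b. openin ?X V}"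
      using qtop unfolding S topology_generated_by_topspace by simp
  qed
  moreover have "open_map ?P (suspension A w) q" unfolding open_map_def
  proof (intro allI impI)
    fix Z assume Z: "openin ?P Z"
    have "\<exists>V a b. openin ?X V \<and> p \<in> V \<times> {a<..<b} \<and> V \<times> {a<..<b} \<subseteq> Z" if "p \<in> Z" for p
    proof -
      obtain x t where [simp]: "p = (x, t)" by (cases p)
      have "(x, t) \<in> Z" using that by simp
      with Z[unfolded openin_prod_topology_alt, rule_format, of x t]
      obtain V I where VI: "openin ?X V" "open I" "x \<in> V" "t \<in> I" "V \<times> I \<subseteq> Z"
        by auto
      obtain e where "e > 0" "ball t e \<subseteq> I" using VI(2,4) by (auto simp: open_contains_ball)
      hence "{t - e<..<t + e} \<subseteq> I" "t \<in> {t - e<..<t + e}" by (auto simp: ball_eq_greaterThanLessThan)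
      hence "openin ?X V \<and> p \<in> V \<times> {t - e<..<t + e} \<and> V \<times> {t - e<..<t + e} \<subseteq> Z"
        using VI by (simp add: subset_iff)
      thus ?thesis by blast
    qed
    hence "Z = \<Union>{V \<times> {a<..<b} | V a b. openin ?X V \<and> V \<times> {a<..<b} \<subseteq> Z}" (is "_ = \<Union>?F")
      by (intro equalityI subsetI) blast+
    hence "q ` Z = \<Union>((`) q ` ?F)" by (metis image_Union)
    moreover have "openin (suspension A w) (\<Union>((`) q ` ?F))"
    proof (rule openin_Union)
      fix B assume "B \<in> (`) q ` ?F"
      hence "B \<in> {q ` (V \<times> {a<..<b}) | V a b. openin ?X V}" by blast
      thus "openin (suspension A w) B" unfolding S by (rule topology_generated_by_Basis)
    qed
    ultimately show "openin (suspension A w) (q ` Z)" by simp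
  qed
  ultimately have "quotient_map ?P (suspension A w) q"
    using qtop by (rule continuous_open_imp_quotient_map)
  thus ?thesis unfolding q_def .
qed


section \<open>Rational Cech cohomology\<close>

text \<open>Cohomology of an open cover is that of its nerve, computed with ordered simplices: an
  \<open>n\<close>-simplex is a list of \<open>n + 1\<close> (not necessarily distinct) members of the cover with nonempty
  intersection. Cochains are made total by the value \<open>0\<close> off the simplices.\<close>

definition cech_simplices :: "nat \<Rightarrow> 'a set set \<Rightarrow> 'a set list set" where
  "cech_simplices n \<U> = {s. length s = Suc n \<and> set s \<subseteq> \<U> \<and> \<Inter>(set s) \<noteq> {}}"

definition cech_cochains :: "nat \<Rightarrow> 'a set set \<Rightarrow> ('a set list \<Rightarrow> rat) set" where
  "cech_cochains n \<U> = {f. \<forall>s. s \<notin> cech_simplices n \<U> \<longrightarrow> f s = 0}"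

definition cech_diff :: "nat \<Rightarrow> 'a set set \<Rightarrow> ('a set list \<Rightarrow> rat) \<Rightarrow> 'a set list \<Rightarrow> rat" where
  "cech_diff n \<U> f s =
     (if s \<in> cech_simplices (Suc n) \<U>
      then \<Sum>i\<le>Suc n. (-1) ^ i * f (take i s @ drop (Suc i) s) else 0)"

definition cech_cocycles :: "nat \<Rightarrow> 'a set set \<Rightarrow> ('a set list \<Rightarrow> rat) set" where
  "cech_cocycles n \<U> = {f \<in> cech_cochains n \<U>. \<forall>s. cech_diff n \<U> f s = 0}"

definition cech_coboundaries :: "nat \<Rightarrow> 'a set set \<Rightarrow> ('a set list \<Rightarrow> rat) set" where
  "cech_coboundaries n \<U> =
     (case n of 0 \<Rightarrow> {\<lambda>_. 0} | Suc m \<Rightarrow> cech_diff m \<U> ` cech_cochains m \<U>)"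

definition open_covers :: "'a topology \<Rightarrow> 'a set set set" where
  "open_covers X = {\<U>. (\<forall>U\<in>\<U>. openin X U) \<and> \<Union>\<U> = topspace X}"

definition refines_by :: "('a set \<Rightarrow> 'a set) \<Rightarrow> 'a set set \<Rightarrow> 'a set set \<Rightarrow> bool" where
  "refines_by \<rho> \<V> \<U> \<longleftrightarrow> (\<forall>V\<in>\<V>. \<rho> V \<in> \<U> \<and> V \<subseteq> \<rho> V)"

definition cech_pullback ::
  "nat \<Rightarrow> 'a set set \<Rightarrow> ('a set \<Rightarrow> 'a set) \<Rightarrow> ('a set list \<Rightarrow> rat) \<Rightarrow> 'a set list \<Rightarrow> rat" where
  "cech_pullback n \<V> \<rho> f s = (if s \<in> cech_simplices n \<V> then f (map \<rho> s) else 0)"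

text \<open>The direct limit of the cohomology groups of the open covers: its elements are represented
  by pairs of a cover and a cocycle, and two of these are identified iff they become cohomologous
  on a common refinement.\<close>

definition cech_reps :: "nat \<Rightarrow> 'a topology \<Rightarrow> ('a set set \<times> ('a set list \<Rightarrow> rat)) set" where
  "cech_reps n X = (SIGMA \<U>:open_covers X. cech_cocycles n \<U>)"

definition cech_rel :: "nat \<Rightarrow> 'a topology \<Rightarrow>
    (('a set set \<times> ('a set list \<Rightarrow> rat)) \<times> ('a set set \<times> ('a set list \<Rightarrow> rat))) set" where
  "cech_rel n X = {((\<U>, f), (\<V>, g)). (\<U>, f) \<in> cech_reps n X \<and> (\<V>, g) \<in> cech_reps n X \<and>
     (\<exists>\<W>\<in>open_covers X. \<exists>\<rho> \<sigma>. refines_by \<rho> \<W> \<U> \<and> refines_by \<sigma> \<W> \<V> \<and>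
        (\<lambda>s. cech_pullback n \<W> \<rho> f s - cech_pullback n \<W> \<sigma> g s) \<in> cech_coboundaries n \<W>)}"

text \<open>Classes are added by representing them on the same cover. The ring multiplication and unit,
  which the record type of modules inherits, play no role. That this is a vector space over the
  rationals is \<open>vectorspace_cech_cohomology\<close> below.\<close>

definition cech_cohomology ::
  "nat \<Rightarrow> 'a topology \<Rightarrow> (rat, ('a set set \<times> ('a set list \<Rightarrow> rat)) set) module" where
  "cech_cohomology n X = \<lparr>
     carrier = cech_reps n X // cech_rel n X,
     mult = undefined, one = undefined,
     zero = cech_rel n X `` {({topspace X}, \<lambda>_. 0)},
     add = (\<lambda>a b. \<Union>{cech_rel n X `` {(\<W>, \<lambda>s. f s + g s)} | \<W> f g. (\<W>, f) \<in> a \<and> (\<W>, g) \<in> b}),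
     smult = (\<lambda>c a. \<Union>{cech_rel n X `` {(\<W>, \<lambda>s. c * f s)} | \<W> f. (\<W>, f) \<in> a}) \<rparr>"


section \<open>Well-definedness of the cohomology\<close>

definition face_sum :: "('b list \<Rightarrow> rat) \<Rightarrow> 'b list \<Rightarrow> rat" where
  "face_sum f s = (\<Sum>i<length s. (-1) ^ i * f (take i s @ drop (Suc i) s))"

lemma face_sum_Nil [simp]: "face_sum f [] = 0"
  by (simp add: face_sum_def)

lemma face_sum_Cons: "face_sum f (x # s) = f s - face_sum (\<lambda>t. f (x # t)) s"
  unfolding face_sum_def
  by (simp add: sum.lessThan_Suc_shift sum_negf del: sum.lessThan_Suc)

lemma face_sum_map: "face_sum f (map \<rho> s) = face_sum (\<lambda>t. f (map \<rho> t)) s"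
  by (simp add: face_sum_def take_map drop_map)

lemma face_sum_diff: "face_sum (\<lambda>t. f t - g t) s = face_sum f s - face_sum g s"
  by (simp add: face_sum_def right_diff_distrib sum_subtractf)

fun prism :: "('b \<Rightarrow> 'c) \<Rightarrow> ('b \<Rightarrow> 'c) \<Rightarrow> ('c list \<Rightarrow> rat) \<Rightarrow> 'b list \<Rightarrow> rat" where
  "prism \<rho> \<sigma> f [] = 0"
| "prism \<rho> \<sigma> f (x # s) = f (\<rho> x # \<sigma> x # map \<sigma> s) - prism \<rho> \<sigma> (\<lambda>t. f (\<rho> x # t)) s"

lemma prism_diff: "prism \<rho> \<sigma> (\<lambda>t. f t - g t) s = prism \<rho> \<sigma> f s - prism \<rho> \<sigma> g s"
  by (induction s arbitrary: f g) auto

lemma prism_homotopy: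
  "face_sum (prism \<rho> \<sigma> f) s + prism \<rho> \<sigma> (face_sum f) s = f (map \<sigma> s) - f (map \<rho> s)"
proof (induction s arbitrary: f)
  case (Cons x s)
  show ?case
    using Cons.IH[of "\<lambda>t. f (\<rho> x # t)"]
    by (simp add: face_sum_Cons face_sum_diff prism_diff face_sum_map)
qed simp

lemma prism_eq_0:
  assumes "\<And>t. length t = Suc (length s) \<Longrightarrow> set t \<subseteq> \<rho> ` set s \<union> \<sigma> ` set s \<Longrightarrow> g t = 0"
  shows "prism \<rho> \<sigma> g s = 0"
  using assms
proof (induction s arbitrary: g)
  case (Cons x s)
  have "prism \<rho> \<sigma> (\<lambda>t. g (\<rho> x # t)) s = 0"
    by (rule Cons.IH) (rule Cons.prems, auto)
  moreover have "g (\<rho> x # \<sigma> x # map \<sigma> s) = 0"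
    by (rule Cons.prems) auto
  ultimately show ?case by simp
qed simp

lemma cech_simplices_face:
  assumes "s \<in> cech_simplices (Suc n) \<U>" "i < length s"
  shows "take i s @ drop (Suc i) s \<in> cech_simplices n \<U>"
proof -
  have sub: "set (take i s @ drop (Suc i) s) \<subseteq> set s"
    using set_take_subset[of i s] set_drop_subset[of "Suc i" s] by auto
  hence "\<Inter>(set s) \<subseteq> \<Inter>(set (take i s @ drop (Suc i) s))" by blast
  thus ?thesis using assms sub unfolding cech_simplices_def by auto
qed

lemma cech_diff_eq:
  "cech_diff n \<U> f s = (if s \<in> cech_simplices (Suc n) \<U> then face_sum f s else 0)"
  by (auto simp: cech_diff_def face_sum_def cech_simplices_def lessThan_Suc_atMost)

lemma face_sum_cong:
  assumes "s \<in> cech_simplices (Suc n) \<U>" "\<And>t. t \<in> cech_simplices n \<U> \<Longrightarrow> f t = g t"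
  shows "face_sum f s = face_sum g s"
  unfolding face_sum_def
proof (rule sum.cong)
  fix i assume "i \<in> {..<length s}"
  thus "(-1) ^ i * f (take i s @ drop (Suc i) s) = (-1) ^ i * g (take i s @ drop (Suc i) s)"
    using assms(2)[OF cech_simplices_face[OF assms(1), of i]] by simp
qed simp

lemma cech_simplices_map:
  assumes "refines_by \<rho> \<V> \<U>" "s \<in> cech_simplices n \<V>"
  shows "map \<rho> s \<in> cech_simplices n \<U>"
proof -
  have "\<Inter>(set s) \<subseteq> \<Inter>(set (map \<rho> s))"
    using assms unfolding refines_by_def cech_simplices_def by fastforce
  thus ?thesis using assms unfolding refines_by_def cech_simplices_def by auto
qed

lemma cech_pullback_cochain: "cech_pullback n \<V> \<rho> f \<in> cech_cochains n \<V>"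
  by (simp add: cech_pullback_def cech_cochains_def)

lemma cech_diff_pullback:
  assumes "refines_by \<rho> \<V> \<U>"
  shows "cech_diff n \<V> (cech_pullback n \<V> \<rho> f) = cech_pullback (Suc n) \<V> \<rho> (cech_diff n \<U> f)"
proof
  fix s
  show "cech_diff n \<V> (cech_pullback n \<V> \<rho> f) s = cech_pullback (Suc n) \<V> \<rho> (cech_diff n \<U> f) s"
  proof (cases "s \<in> cech_simplices (Suc n) \<V>")
    case True
    have "face_sum (cech_pullback n \<V> \<rho> f) s = face_sum (\<lambda>t. f (map \<rho> t)) s"
      by (rule face_sum_cong[OF True]) (simp add: cech_pullback_def)
    thus ?thesis using True cech_simplices_map[OF assms True]
      by (simp add: cech_diff_eq cech_pullback_def face_sum_map)
  qed (simp add: cech_diff_eq cech_pullback_def)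
qed

lemma cech_pullback_cocycle:
  assumes "refines_by \<rho> \<V> \<U>" "f \<in> cech_cocycles n \<U>"
  shows "cech_pullback n \<V> \<rho> f \<in> cech_cocycles n \<V>"
proof -
  have "cech_diff n \<V> (cech_pullback n \<V> \<rho> f) s = 0" for s
    using assms unfolding cech_diff_pullback[OF assms(1)]
    by (simp add: cech_pullback_def cech_cocycles_def)
  thus ?thesis by (simp add: cech_cocycles_def cech_pullback_cochain)
qed

lemma cech_pullback_coboundary:
  assumes "refines_by \<rho> \<V> \<U>" "f \<in> cech_coboundaries n \<U>"
  shows "cech_pullback n \<V> \<rho> f \<in> cech_coboundaries n \<V>"
proof (cases n)
  case 0
  thus ?thesis using assms by (auto simp: cech_coboundaries_def cech_pullback_def)
next
  case (Suc m)
  then obtain h where h: "f = cech_diff m \<U> h"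
    using assms by (auto simp: cech_coboundaries_def)
  show ?thesis
    using cech_diff_pullback[OF assms(1), of m h] Suc cech_pullback_cochain[of m \<V> \<rho> h]
    by (auto simp: cech_coboundaries_def h image_iff intro!: bexI[of _ "cech_pullback m \<V> \<rho> h"])
qed

lemma cech_pullback_comp:
  assumes "refines_by \<sigma> \<W> \<V>"
  shows "cech_pullback n \<W> \<sigma> (cech_pullback n \<V> \<rho> f) = cech_pullback n \<W> (\<rho> \<circ> \<sigma>) f"
  using cech_simplices_map[OF assms] by (auto simp: cech_pullback_def)

lemma cech_pullback_id:
  assumes "f \<in> cech_cochains n \<U>"
  shows "cech_pullback n \<U> (\<lambda>x. x) f = f"
  using assms by (auto simp: cech_pullback_def cech_cochains_def)

lemma cech_pullback_linear:
  "cech_pullback n \<V> \<rho> (\<lambda>s. f s + g s) = (\<lambda>s. cech_pullback n \<V> \<rho> f s + cech_pullback n \<V> \<rho> g s)"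
  "cech_pullback n \<V> \<rho> (\<lambda>s. f s - g s) = (\<lambda>s. cech_pullback n \<V> \<rho> f s - cech_pullback n \<V> \<rho> g s)"
  "cech_pullback n \<V> \<rho> (\<lambda>s. c * f s) = (\<lambda>s. c * cech_pullback n \<V> \<rho> f s)"
  "cech_pullback n \<V> \<rho> (\<lambda>s. 0) = (\<lambda>s. 0)"
  by (auto simp: cech_pullback_def)

lemma cech_diff_linear:
  "cech_diff n \<U> (\<lambda>s. f s + g s) = (\<lambda>s. cech_diff n \<U> f s + cech_diff n \<U> g s)"
  "cech_diff n \<U> (\<lambda>s. c * f s) = (\<lambda>s. c * cech_diff n \<U> f s)"
  "cech_diff n \<U> (\<lambda>s. 0) = (\<lambda>s. 0)"
  by (auto simp: cech_diff_eq face_sum_def algebra_simps sum.distrib sum_distrib_left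
      intro!: ext)

lemma cech_cocycles_linear:
  "f \<in> cech_cocycles n \<U> \<Longrightarrow> g \<in> cech_cocycles n \<U> \<Longrightarrow> (\<lambda>s. f s + g s) \<in> cech_cocycles n \<U>"
  "f \<in> cech_cocycles n \<U> \<Longrightarrow> (\<lambda>s. c * f s) \<in> cech_cocycles n \<U>"
  "(\<lambda>s. 0) \<in> cech_cocycles n \<U>"
  by (auto simp: cech_cocycles_def cech_cochains_def cech_diff_linear)

lemma cech_coboundaries_linear:
  "f \<in> cech_coboundaries n \<U> \<Longrightarrow> g \<in> cech_coboundaries n \<U> \<Longrightarrow>
     (\<lambda>s. f s + g s) \<in> cech_coboundaries n \<U>"
  "f \<in> cech_coboundaries n \<U> \<Longrightarrow> (\<lambda>s. c * f s) \<in> cech_coboundaries n \<U>"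
  "(\<lambda>s. 0) \<in> cech_coboundaries n \<U>"
proof -
  have z: "(\<lambda>s. 0) \<in> cech_cochains m \<U>" for m by (simp add: cech_cochains_def)
  have add: "(\<lambda>s. u s + v s) \<in> cech_cochains m \<U>"
    if "u \<in> cech_cochains m \<U>" "v \<in> cech_cochains m \<U>" for u v m
    using that by (simp add: cech_cochains_def)
  have sc: "(\<lambda>s. c * u s) \<in> cech_cochains m \<U>" if "u \<in> cech_cochains m \<U>" for u m
    using that by (simp add: cech_cochains_def)
  show "(\<lambda>s. 0) \<in> cech_coboundaries n \<U>"
    by (cases n) (auto simp: cech_coboundaries_def image_iff intro!: bexI[OF _ z]
        simp: cech_diff_linear)
  show "(\<lambda>s. f s + g s) \<in> cech_coboundaries n \<U>"
    if fg: "f \<in> cech_coboundaries n \<U>" "g \<in> cech_coboundaries n \<U>"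
  proof (cases n)
    case (Suc m)
    then obtain u v where "f = cech_diff m \<U> u" "g = cech_diff m \<U> v"
      "u \<in> cech_cochains m \<U>" "v \<in> cech_cochains m \<U>"
      using fg Suc by (auto simp: cech_coboundaries_def)
    thus ?thesis using Suc add[of u m v]
      by (auto simp: cech_coboundaries_def image_iff cech_diff_linear
          intro!: bexI[of _ "\<lambda>s. u s + v s"])
  qed (use fg in \<open>auto simp: cech_coboundaries_def\<close>)
  show "(\<lambda>s. c * f s) \<in> cech_coboundaries n \<U>" if f: "f \<in> cech_coboundaries n \<U>"
  proof (cases n)
    case (Suc m)
    then obtain u where "f = cech_diff m \<U> u" "u \<in> cech_cochains m \<U>"
      using f Suc by (auto simp: cech_coboundaries_def)
    thus ?thesis using Suc sc[of u m]
      by (auto simp: cech_coboundaries_def image_iff cech_diff_linear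
          intro!: bexI[of _ "\<lambda>s. c * u s"])
  qed (use f in \<open>auto simp: cech_coboundaries_def\<close>)
qed

text \<open>The map induced by a refinement does not depend on the choice of the refinement map.\<close>

lemma cech_pullback_unique:
  assumes "refines_by \<rho> \<V> \<U>" "refines_by \<sigma> \<V> \<U>" "f \<in> cech_cocycles n \<U>"
  shows "(\<lambda>s. cech_pullback n \<V> \<sigma> f s - cech_pullback n \<V> \<rho> f s) \<in> cech_coboundaries n \<V>"
proof -
  have eq: "face_sum (prism \<rho> \<sigma> f) s = f (map \<sigma> s) - f (map \<rho> s)"
    if s: "s \<in> cech_simplices n \<V>" for s
  proof -
    have "prism \<rho> \<sigma> (face_sum f) s = 0"
    proof (rule prism_eq_0)
      fix t assume t: "length t = Suc (length s)" "set t \<subseteq> \<rho> ` set s \<union> \<sigma> ` set s"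
      have "\<Inter>(set s) \<subseteq> \<Inter>(set t)"
        using t(2) s assms(1,2) unfolding refines_by_def cech_simplices_def by fastforce
      moreover have "set t \<subseteq> \<U>"
        using t(2) s assms(1,2) unfolding refines_by_def cech_simplices_def by fastforce
      ultimately have "t \<in> cech_simplices (Suc n) \<U>"
        using t s unfolding cech_simplices_def by auto
      moreover have "cech_diff n \<U> f t = 0"
        using assms(3) by (simp add: cech_cocycles_def)
      ultimately show "face_sum f t = 0" by (simp add: cech_diff_eq)
    qed
    thus ?thesis using prism_homotopy[of \<rho> \<sigma> f s] by simp
  qed
  show ?thesis
  proof (cases n)
    case 0
    have "face_sum (prism \<rho> \<sigma> f) s = 0" if "s \<in> cech_simplices n \<V>" for s
    proof -
      obtain x where "s = [x]"
        using \<open>s \<in> cech_simplices n \<V>\<close> 0 by (auto simp: cech_simplices_def length_Suc_conv)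
      thus ?thesis by (simp add: face_sum_Cons)
    qed
    hence "(\<lambda>s. cech_pullback n \<V> \<sigma> f s - cech_pullback n \<V> \<rho> f s) = (\<lambda>s. 0)"
      using eq by (auto simp: cech_pullback_def)
    thus ?thesis using 0 by (simp add: cech_coboundaries_def)
  next
    case (Suc m)
    define h where "h = (\<lambda>s. if s \<in> cech_simplices m \<V> then prism \<rho> \<sigma> f s else 0)"
    have "cech_diff m \<V> h s = cech_pullback n \<V> \<sigma> f s - cech_pullback n \<V> \<rho> f s" for s
    proof (cases "s \<in> cech_simplices n \<V>")
      case True
      hence "face_sum h s = face_sum (prism \<rho> \<sigma> f) s"
        using Suc by (intro face_sum_cong[of s m \<V>]) (auto simp: h_def)
      thus ?thesis using True Suc eq by (simp add: cech_diff_eq cech_pullback_def)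
    qed (simp add: cech_diff_eq cech_pullback_def Suc)
    moreover have "h \<in> cech_cochains m \<V>" by (simp add: h_def cech_cochains_def)
    ultimately show ?thesis
      unfolding cech_coboundaries_def Suc by (auto simp: image_iff fun_eq_iff intro!: bexI[of _ h])
  qed
qed

lemma open_covers_common_refinement:
  assumes "\<U> \<in> open_covers X" "\<V> \<in> open_covers X"
  obtains \<W> \<rho> \<sigma> where "\<W> \<in> open_covers X" "refines_by \<rho> \<W> \<U>" "refines_by \<sigma> \<W> \<V>"
proof -
  define \<W> where "\<W> = {U \<inter> V | U V. U \<in> \<U> \<and> V \<in> \<V>}"
  have "\<Union>\<W> = \<Union>\<U> \<inter> \<Union>\<V>" by (auto simp: \<W>_def)
  hence "\<W> \<in> open_covers X" using assms by (auto simp: open_covers_def \<W>_def)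
  moreover have "\<forall>W\<in>\<W>. \<exists>U\<in>\<U>. W \<subseteq> U" "\<forall>W\<in>\<W>. \<exists>V\<in>\<V>. W \<subseteq> V" by (auto simp: \<W>_def)
  hence "\<exists>\<rho>. \<forall>W\<in>\<W>. \<rho> W \<in> \<U> \<and> W \<subseteq> \<rho> W" "\<exists>\<sigma>. \<forall>W\<in>\<W>. \<sigma> W \<in> \<V> \<and> W \<subseteq> \<sigma> W"
    by metis+
  ultimately show ?thesis using that unfolding refines_by_def by blast
qed

lemma refines_by_comp:
  "refines_by \<rho> \<V> \<U> \<Longrightarrow> refines_by \<sigma> \<W> \<V> \<Longrightarrow> refines_by (\<rho> \<circ> \<sigma>) \<W> \<U>"
  unfolding refines_by_def by fastforce

lemma refines_by_id: "refines_by (\<lambda>x. x) \<U> \<U>"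
  by (simp add: refines_by_def)

lemma cech_relI:
  assumes "(\<U>, f) \<in> cech_reps n X" "(\<V>, g) \<in> cech_reps n X" "\<W> \<in> open_covers X"
    "refines_by \<rho> \<W> \<U>" "refines_by \<sigma> \<W> \<V>"
    "(\<lambda>s. cech_pullback n \<W> \<rho> f s - cech_pullback n \<W> \<sigma> g s) \<in> cech_coboundaries n \<W>"
  shows "((\<U>, f), (\<V>, g)) \<in> cech_rel n X"
  using assms unfolding cech_rel_def by blast

lemma cech_relE:
  assumes "((\<U>, f), (\<V>, g)) \<in> cech_rel n X"
  obtains \<W> \<rho> \<sigma> where "\<W> \<in> open_covers X" "refines_by \<rho> \<W> \<U>" "refines_by \<sigma> \<W> \<V>"
    "(\<lambda>s. cech_pullback n \<W> \<rho> f s - cech_pullback n \<W> \<sigma> g s) \<in> cech_coboundaries n \<W>"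
    "\<U> \<in> open_covers X" "\<V> \<in> open_covers X" "f \<in> cech_cocycles n \<U>" "g \<in> cech_cocycles n \<V>"
  using assms unfolding cech_rel_def cech_reps_def by blast

lemma cech_rel_refine:
  assumes "(\<lambda>s. cech_pullback n \<W> \<rho> f s - cech_pullback n \<W> \<sigma> g s) \<in> cech_coboundaries n \<W>"
    and "refines_by \<alpha> \<T> \<W>"
  shows "(\<lambda>s. cech_pullback n \<T> (\<rho> \<circ> \<alpha>) f s - cech_pullback n \<T> (\<sigma> \<circ> \<alpha>) g s)
      \<in> cech_coboundaries n \<T>"
  using cech_pullback_coboundary[OF assms(2,1)]
  by (simp add: cech_pullback_linear cech_pullback_comp[OF assms(2)])

lemma equiv_cech_rel: "equiv (cech_reps n X) (cech_rel n X)"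
proof (rule equivI)
  show "cech_rel n X \<subseteq> cech_reps n X \<times> cech_reps n X" by (auto simp: cech_rel_def)
  show "refl_on (cech_reps n X) (cech_rel n X)"
  proof (rule refl_onI)
    fix p assume p: "p \<in> cech_reps n X"
    obtain \<U> f where [simp]: "p = (\<U>, f)" by (cases p)
    show "(p, p) \<in> cech_rel n X"
      using p by (auto intro!: cech_relI[where \<W> = \<U>] refines_by_id
          simp: cech_coboundaries_linear cech_reps_def)
  qed
  show "sym (cech_rel n X)"
  proof (rule symI)
    fix p q assume pq: "(p, q) \<in> cech_rel n X"
    obtain \<U> f where p: "p = (\<U>, f)" by (cases p)
    obtain \<V> g where q: "q = (\<V>, g)" by (cases q)
    from pq p q have "((\<U>, f), (\<V>, g)) \<in> cech_rel n X" by simp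
    then show "(q, p) \<in> cech_rel n X" unfolding p q
    proof (cases rule: cech_relE)
      case (1 \<W> \<rho> \<sigma>)
      have "(\<lambda>s. cech_pullback n \<W> \<sigma> g s - cech_pullback n \<W> \<rho> f s) \<in> cech_coboundaries n \<W>"
        using cech_coboundaries_linear(2)[OF 1(4), of "-1"] by simp
      thus "((\<V>, g), (\<U>, f)) \<in> cech_rel n X"
        using 1 by (intro cech_relI[where \<W> = \<W>]) (auto simp: cech_reps_def)
    qed
  qed
  show "trans (cech_rel n X)"
  proof (rule transI)
    fix p q r assume pq: "(p, q) \<in> cech_rel n X" and qr: "(q, r) \<in> cech_rel n X"
    obtain \<U> f where p: "p = (\<U>, f)" by (cases p)
    obtain \<V> g where q: "q = (\<V>, g)" by (cases q)
    obtain \<T> h where r: "r = (\<T>, h)" by (cases r)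
    from pq[unfolded p q] obtain \<W> \<rho> \<sigma> where 1: "\<W> \<in> open_covers X" "refines_by \<rho> \<W> \<U>"
      "refines_by \<sigma> \<W> \<V>"
      "(\<lambda>s. cech_pullback n \<W> \<rho> f s - cech_pullback n \<W> \<sigma> g s) \<in> cech_coboundaries n \<W>"
      "\<U> \<in> open_covers X" "\<V> \<in> open_covers X" "f \<in> cech_cocycles n \<U>" "g \<in> cech_cocycles n \<V>"
      by (rule cech_relE)
    from qr[unfolded q r] obtain \<W>' \<rho>' \<sigma>' where 2: "\<W>' \<in> open_covers X" "refines_by \<rho>' \<W>' \<V>"
      "refines_by \<sigma>' \<W>' \<T>"
      "(\<lambda>s. cech_pullback n \<W>' \<rho>' g s - cech_pullback n \<W>' \<sigma>' h s) \<in> cech_coboundaries n \<W>'"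
      "\<V> \<in> open_covers X" "\<T> \<in> open_covers X" "g \<in> cech_cocycles n \<V>" "h \<in> cech_cocycles n \<T>"
      by (rule cech_relE)
    obtain \<Z> \<alpha> \<beta> where 3: "\<Z> \<in> open_covers X" "refines_by \<alpha> \<Z> \<W>" "refines_by \<beta> \<Z> \<W>'"
      using open_covers_common_refinement[OF 1(1) 2(1)] .
    note A = cech_rel_refine[OF 1(4) 3(2)]
    note B = cech_rel_refine[OF 2(4) 3(3)]
    note C = cech_pullback_unique[OF refines_by_comp[OF 2(2) 3(3)] refines_by_comp[OF 1(3) 3(2)] 1(8)]
    have "(\<lambda>s. cech_pullback n \<Z> (\<rho> \<circ> \<alpha>) f s - cech_pullback n \<Z> (\<sigma>' \<circ> \<beta>) h s)
        \<in> cech_coboundaries n \<Z>"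
      using cech_coboundaries_linear(1)[OF cech_coboundaries_linear(1)[OF A C] B] by simp
    thus "(p, r) \<in> cech_rel n X" unfolding p r
      using 1 2 3 by (intro cech_relI[where \<W> = \<Z>])
        (auto simp: cech_reps_def intro: refines_by_comp)
  qed
qed

lemma cech_rel_pullback:
  assumes "(\<U>, f) \<in> cech_reps n X" "\<V> \<in> open_covers X" "refines_by \<rho> \<V> \<U>"
  shows "((\<U>, f), (\<V>, cech_pullback n \<V> \<rho> f)) \<in> cech_rel n X"
proof (rule cech_relI[where \<W> = \<V> and \<rho> = \<rho> and \<sigma> = "\<lambda>x. x"])
  show "(\<V>, cech_pullback n \<V> \<rho> f) \<in> cech_reps n X"
    using assms cech_pullback_cocycle[OF assms(3)] by (auto simp: cech_reps_def)
qed (use assms in \<open>auto simp: cech_pullback_id cech_pullback_cochain cech_coboundaries_linear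
    refines_by_id\<close>)

lemma cech_rel_add:
  assumes "((\<U>, f), (\<V>, g)) \<in> cech_rel n X" "((\<U>, f'), (\<V>, g')) \<in> cech_rel n X"
  shows "((\<U>, \<lambda>s. f s + f' s), (\<V>, \<lambda>s. g s + g' s)) \<in> cech_rel n X"
proof -
  from assms(1) obtain \<W> \<rho> \<sigma> where 1: "\<W> \<in> open_covers X" "refines_by \<rho> \<W> \<U>"
    "refines_by \<sigma> \<W> \<V>"
    "(\<lambda>s. cech_pullback n \<W> \<rho> f s - cech_pullback n \<W> \<sigma> g s) \<in> cech_coboundaries n \<W>"
    "\<U> \<in> open_covers X" "\<V> \<in> open_covers X" "f \<in> cech_cocycles n \<U>" "g \<in> cech_cocycles n \<V>"
    by (rule cech_relE)
  from assms(2) obtain \<W>' \<rho>' \<sigma>' where 2: "\<W>' \<in> open_covers X" "refines_by \<rho>' \<W>' \<U>"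
    "refines_by \<sigma>' \<W>' \<V>"
    "(\<lambda>s. cech_pullback n \<W>' \<rho>' f' s - cech_pullback n \<W>' \<sigma>' g' s) \<in> cech_coboundaries n \<W>'"
    "\<U> \<in> open_covers X" "\<V> \<in> open_covers X" "f' \<in> cech_cocycles n \<U>" "g' \<in> cech_cocycles n \<V>"
    by (rule cech_relE)
  obtain \<Z> \<alpha> \<beta> where 3: "\<Z> \<in> open_covers X" "refines_by \<alpha> \<Z> \<W>" "refines_by \<beta> \<Z> \<W>'"
    using open_covers_common_refinement[OF 1(1) 2(1)] .
  note A = cech_rel_refine[OF 1(4) 3(2)]
  note B = cech_rel_refine[OF 2(4) 3(3)]
  note C = cech_pullback_unique[OF refines_by_comp[OF 2(2) 3(3)] refines_by_comp[OF 1(2) 3(2)] 2(7)]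
  note D = cech_pullback_unique[OF refines_by_comp[OF 1(3) 3(2)] refines_by_comp[OF 2(3) 3(3)] 2(8)]
  have "(\<lambda>s. cech_pullback n \<Z> (\<rho> \<circ> \<alpha>) (\<lambda>s. f s + f' s) s
           - cech_pullback n \<Z> (\<sigma> \<circ> \<alpha>) (\<lambda>s. g s + g' s) s) \<in> cech_coboundaries n \<Z>"
    using cech_coboundaries_linear(1)[OF A
        cech_coboundaries_linear(1)[OF C cech_coboundaries_linear(1)[OF B D]]]
    by (simp add: cech_pullback_linear algebra_simps)
  thus ?thesis
    using 1 2 3 by (intro cech_relI[where \<W> = \<Z>])
      (auto simp: cech_reps_def cech_cocycles_linear intro: refines_by_comp)
qed

lemma cech_rel_smult:
  assumes "((\<U>, f), (\<V>, g)) \<in> cech_rel n X"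
  shows "((\<U>, \<lambda>s. c * f s), (\<V>, \<lambda>s. c * g s)) \<in> cech_rel n X"
proof -
  from assms obtain \<W> \<rho> \<sigma> where 1: "\<W> \<in> open_covers X" "refines_by \<rho> \<W> \<U>"
    "refines_by \<sigma> \<W> \<V>"
    "(\<lambda>s. cech_pullback n \<W> \<rho> f s - cech_pullback n \<W> \<sigma> g s) \<in> cech_coboundaries n \<W>"
    "\<U> \<in> open_covers X" "\<V> \<in> open_covers X" "f \<in> cech_cocycles n \<U>" "g \<in> cech_cocycles n \<V>"
    by (rule cech_relE)
  show ?thesis
    using 1 cech_coboundaries_linear(2)[OF 1(4), of c]
    by (intro cech_relI[where \<W> = \<W>])
      (auto simp: cech_reps_def cech_cocycles_linear cech_pullback_linear algebra_simps)
qed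

abbreviation cech_class ::
  "nat \<Rightarrow> 'a topology \<Rightarrow> 'a set set \<Rightarrow> ('a set list \<Rightarrow> rat) \<Rightarrow> ('a set set \<times> ('a set list \<Rightarrow> rat)) set" where
  "cech_class n X \<U> f \<equiv> cech_rel n X `` {(\<U>, f)}"

lemma cech_class_eqI:
  "((\<U>, f), (\<V>, g)) \<in> cech_rel n X \<Longrightarrow> cech_class n X \<U> f = cech_class n X \<V> g"
  using equiv_class_eq[OF equiv_cech_rel] by blast

lemma cech_class_carrier:
  "\<U> \<in> open_covers X \<Longrightarrow> f \<in> cech_cocycles n \<U> \<Longrightarrow>
    cech_class n X \<U> f \<in> carrier (cech_cohomology n X)"
  by (auto simp: cech_cohomology_def cech_reps_def intro!: quotientI)

lemma cech_class_refine:
  assumes "\<U> \<in> open_covers X" "f \<in> cech_cocycles n \<U>" "\<V> \<in> open_covers X" "refines_by \<rho> \<V> \<U>"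
  shows "cech_class n X \<U> f = cech_class n X \<V> (cech_pullback n \<V> \<rho> f)"
  using assms by (intro cech_class_eqI cech_rel_pullback) (auto simp: cech_reps_def)

lemma cech_carrierE:
  assumes "a \<in> carrier (cech_cohomology n X)"
  obtains \<U> f where "\<U> \<in> open_covers X" "f \<in> cech_cocycles n \<U>" "a = cech_class n X \<U> f"
  using assms by (auto simp: cech_cohomology_def cech_reps_def elim!: quotientE)

lemma cech_carrierE2:
  assumes "a \<in> carrier (cech_cohomology n X)" "b \<in> carrier (cech_cohomology n X)"
  obtains \<W> f g where "\<W> \<in> open_covers X" "f \<in> cech_cocycles n \<W>" "g \<in> cech_cocycles n \<W>"
    "a = cech_class n X \<W> f" "b = cech_class n X \<W> g"
proof -
  obtain \<U> f where 1: "\<U> \<in> open_covers X" "f \<in> cech_cocycles n \<U>" "a = cech_class n X \<U> f"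
    using assms(1) by (rule cech_carrierE)
  obtain \<V> g where 2: "\<V> \<in> open_covers X" "g \<in> cech_cocycles n \<V>" "b = cech_class n X \<V> g"
    using assms(2) by (rule cech_carrierE)
  obtain \<W> \<rho> \<sigma> where 3: "\<W> \<in> open_covers X" "refines_by \<rho> \<W> \<U>" "refines_by \<sigma> \<W> \<V>"
    using open_covers_common_refinement[OF 1(1) 2(1)] .
  show ?thesis
    using that[OF 3(1) cech_pullback_cocycle[OF 3(2) 1(2)] cech_pullback_cocycle[OF 3(3) 2(2)]]
      cech_class_refine[OF 1(1,2) 3(1,2)] cech_class_refine[OF 2(1,2) 3(1,3)] 1 2 by simp
qed

lemma cech_carrierE3:
  assumes "a \<in> carrier (cech_cohomology n X)" "b \<in> carrier (cech_cohomology n X)"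
    "c \<in> carrier (cech_cohomology n X)"
  obtains \<W> f g h where "\<W> \<in> open_covers X" "f \<in> cech_cocycles n \<W>" "g \<in> cech_cocycles n \<W>"
    "h \<in> cech_cocycles n \<W>"
    "a = cech_class n X \<W> f" "b = cech_class n X \<W> g" "c = cech_class n X \<W> h"
proof -
  obtain \<U> f g where 1: "\<U> \<in> open_covers X" "f \<in> cech_cocycles n \<U>" "g \<in> cech_cocycles n \<U>"
    "a = cech_class n X \<U> f" "b = cech_class n X \<U> g"
    using assms(1,2) by (rule cech_carrierE2)
  obtain \<V> h where 2: "\<V> \<in> open_covers X" "h \<in> cech_cocycles n \<V>" "c = cech_class n X \<V> h"
    using assms(3) by (rule cech_carrierE)
  obtain \<W> \<rho> \<sigma> where 3: "\<W> \<in> open_covers X" "refines_by \<rho> \<W> \<U>" "refines_by \<sigma> \<W> \<V>"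
    using open_covers_common_refinement[OF 1(1) 2(1)] .
  show ?thesis
    using that[OF 3(1) cech_pullback_cocycle[OF 3(2) 1(2)] cech_pullback_cocycle[OF 3(2) 1(3)]
        cech_pullback_cocycle[OF 3(3) 2(2)]]
      cech_class_refine[OF 1(1,2) 3(1,2)] cech_class_refine[OF 1(1,3) 3(1,2)]
      cech_class_refine[OF 2(1,2) 3(1,3)] 1 2 by simp
qed

lemma cech_class_self:
  "\<U> \<in> open_covers X \<Longrightarrow> f \<in> cech_cocycles n \<U> \<Longrightarrow> (\<U>, f) \<in> cech_class n X \<U> f"
  using equiv_class_self[OF equiv_cech_rel] by (auto simp: cech_reps_def)

lemma cech_add:
  assumes "\<U> \<in> open_covers X" "f \<in> cech_cocycles n \<U>" "g \<in> cech_cocycles n \<U>"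
  shows "cech_class n X \<U> f \<oplus>\<^bsub>cech_cohomology n X\<^esub> cech_class n X \<U> g
    = cech_class n X \<U> (\<lambda>s. f s + g s)"
proof -
  have eq: "cech_class n X \<W> (\<lambda>s. f' s + g' s) = cech_class n X \<U> (\<lambda>s. f s + g s)"
    if "(\<W>, f') \<in> cech_class n X \<U> f" "(\<W>, g') \<in> cech_class n X \<U> g" for \<W> f' g'
    using cech_class_eqI[OF cech_rel_add[of \<U> f \<W> f' n X g g']] that by auto
  have "{cech_class n X \<W> (\<lambda>s. f' s + g' s) | \<W> f' g'.
      (\<W>, f') \<in> cech_class n X \<U> f \<and> (\<W>, g') \<in> cech_class n X \<U> g}
    = {cech_class n X \<U> (\<lambda>s. f s + g s)}"
  proof (intro equalityI subsetI)
    fix z assume "z \<in> {cech_class n X \<U> (\<lambda>s. f s + g s)}"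
    thus "z \<in> {cech_class n X \<W> (\<lambda>s. f' s + g' s) | \<W> f' g'.
      (\<W>, f') \<in> cech_class n X \<U> f \<and> (\<W>, g') \<in> cech_class n X \<U> g}"
      using cech_class_self[OF assms(1,2)] cech_class_self[OF assms(1,3)] by blast
  next
    fix z assume "z \<in> {cech_class n X \<W> (\<lambda>s. f' s + g' s) | \<W> f' g'.
      (\<W>, f') \<in> cech_class n X \<U> f \<and> (\<W>, g') \<in> cech_class n X \<U> g}"
    thus "z \<in> {cech_class n X \<U> (\<lambda>s. f s + g s)}" using eq by blast
  qed
  thus ?thesis by (simp add: cech_cohomology_def)
qed

lemma cech_smult:
  assumes "\<U> \<in> open_covers X" "f \<in> cech_cocycles n \<U>"
  shows "c \<odot>\<^bsub>cech_cohomology n X\<^esub> cech_class n X \<U> f = cech_class n X \<U> (\<lambda>s. c * f s)"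
proof -
  have eq: "cech_class n X \<W> (\<lambda>s. c * f' s) = cech_class n X \<U> (\<lambda>s. c * f s)"
    if "(\<W>, f') \<in> cech_class n X \<U> f" for \<W> f'
    using cech_class_eqI[OF cech_rel_smult[of \<U> f \<W> f' n X c]] that by auto
  have "{cech_class n X \<W> (\<lambda>s. c * f' s) | \<W> f'. (\<W>, f') \<in> cech_class n X \<U> f}
    = {cech_class n X \<U> (\<lambda>s. c * f s)}"
  proof (intro equalityI subsetI)
    fix z assume "z \<in> {cech_class n X \<U> (\<lambda>s. c * f s)}"
    thus "z \<in> {cech_class n X \<W> (\<lambda>s. c * f' s) | \<W> f'. (\<W>, f') \<in> cech_class n X \<U> f}"
      using cech_class_self[OF assms(1,2)] by blast
  next
    fix z assume "z \<in> {cech_class n X \<W> (\<lambda>s. c * f' s) | \<W> f'. (\<W>, f') \<in> cech_class n X \<U> f}"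
    thus "z \<in> {cech_class n X \<U> (\<lambda>s. c * f s)}" using eq by blast
  qed
  thus ?thesis by (simp add: cech_cohomology_def)
qed

lemma trivial_open_cover: "{topspace X} \<in> open_covers X"
  by (simp add: open_covers_def)

lemma cech_zero:
  assumes "\<U> \<in> open_covers X"
  shows "\<zero>\<^bsub>cech_cohomology n X\<^esub> = cech_class n X \<U> (\<lambda>s. 0)"
proof -
  have "refines_by (\<lambda>_. topspace X) \<U> {topspace X}"
    using assms by (auto simp: refines_by_def open_covers_def)
  from cech_class_refine[OF trivial_open_cover _ assms this, of "\<lambda>s. 0" n]
  show ?thesis by (simp add: cech_cohomology_def cech_cocycles_linear cech_pullback_linear)
qed

lemma vectorspace_cech_cohomology:
  "vectorspace (class_ring :: rat ring) (cech_cohomology n X)"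
proof -
  let ?M = "cech_cohomology n X"
  note lin = cech_cocycles_linear
  have ab: "abelian_group ?M"
  proof (rule abelian_groupI)
    fix x y assume "x \<in> carrier ?M" "y \<in> carrier ?M"
    then obtain \<W> f g where *: "\<W> \<in> open_covers X" "f \<in> cech_cocycles n \<W>" "g \<in> cech_cocycles n \<W>"
      "x = cech_class n X \<W> f" "y = cech_class n X \<W> g" by (rule cech_carrierE2)
    show "x \<oplus>\<^bsub>?M\<^esub> y \<in> carrier ?M"
      using * by (simp add: cech_add cech_class_carrier lin)
    show "x \<oplus>\<^bsub>?M\<^esub> y = y \<oplus>\<^bsub>?M\<^esub> x"
      using * by (simp add: cech_add add.commute)
  next
    show "\<zero>\<^bsub>?M\<^esub> \<in> carrier ?M"
      unfolding cech_zero[OF trivial_open_cover]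
      by (intro cech_class_carrier trivial_open_cover lin)
  next
    fix x y z assume "x \<in> carrier ?M" "y \<in> carrier ?M" "z \<in> carrier ?M"
    then obtain \<W> f g h where *: "\<W> \<in> open_covers X" "f \<in> cech_cocycles n \<W>"
      "g \<in> cech_cocycles n \<W>" "h \<in> cech_cocycles n \<W>"
      "x = cech_class n X \<W> f" "y = cech_class n X \<W> g" "z = cech_class n X \<W> h"
      by (rule cech_carrierE3)
    show "x \<oplus>\<^bsub>?M\<^esub> y \<oplus>\<^bsub>?M\<^esub> z = x \<oplus>\<^bsub>?M\<^esub> (y \<oplus>\<^bsub>?M\<^esub> z)"
      using * by (simp add: cech_add lin add.assoc)
  next
    fix x assume "x \<in> carrier ?M"
    then obtain \<W> f where *: "\<W> \<in> open_covers X" "f \<in> cech_cocycles n \<W>"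
      "x = cech_class n X \<W> f" by (rule cech_carrierE)
    show "\<zero>\<^bsub>?M\<^esub> \<oplus>\<^bsub>?M\<^esub> x = x"
      using * by (simp add: cech_zero[OF *(1)] cech_add lin)
    have "cech_class n X \<W> (\<lambda>s. (-1) * f s) \<oplus>\<^bsub>?M\<^esub> x = \<zero>\<^bsub>?M\<^esub>"
      unfolding *(3) cech_zero[OF *(1)] cech_add[OF *(1) lin(2)[OF *(2)] *(2)] by simp
    moreover have "cech_class n X \<W> (\<lambda>s. (-1) * f s) \<in> carrier ?M"
      using * by (intro cech_class_carrier lin)
    ultimately show "\<exists>y\<in>carrier ?M. y \<oplus>\<^bsub>?M\<^esub> x = \<zero>\<^bsub>?M\<^esub>" by blast
  qed
  have K: "Ring.field (class_ring :: rat ring)" by (rule class_field.field_axioms)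
  have "module (class_ring :: rat ring) ?M"
  proof (rule moduleI)
    show "cring (class_ring :: rat ring)" using K by (rule fieldE)
    show "abelian_group ?M" by (rule ab)
  next
    fix a :: rat and x assume "x \<in> carrier ?M"
    then obtain \<W> f where *: "\<W> \<in> open_covers X" "f \<in> cech_cocycles n \<W>"
      "x = cech_class n X \<W> f" by (rule cech_carrierE)
    show "a \<odot>\<^bsub>?M\<^esub> x \<in> carrier ?M"
      using * by (simp add: cech_smult cech_class_carrier lin)
    show "\<one>\<^bsub>class_ring\<^esub> \<odot>\<^bsub>?M\<^esub> x = x"
      using * by (simp add: cech_smult)
    fix b :: rat
    show "(a \<oplus>\<^bsub>class_ring\<^esub> b) \<odot>\<^bsub>?M\<^esub> x = a \<odot>\<^bsub>?M\<^esub> x \<oplus>\<^bsub>?M\<^esub> b \<odot>\<^bsub>?M\<^esub> x"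
      using * by (simp add: cech_smult cech_add lin distrib_right)
    show "(a \<otimes>\<^bsub>class_ring\<^esub> b) \<odot>\<^bsub>?M\<^esub> x = a \<odot>\<^bsub>?M\<^esub> (b \<odot>\<^bsub>?M\<^esub> x)"
      using * by (simp add: cech_smult lin mult.assoc)
  next
    fix a :: rat and x y assume "x \<in> carrier ?M" "y \<in> carrier ?M"
    then obtain \<W> f g where *: "\<W> \<in> open_covers X" "f \<in> cech_cocycles n \<W>" "g \<in> cech_cocycles n \<W>"
      "x = cech_class n X \<W> f" "y = cech_class n X \<W> g" by (rule cech_carrierE2)
    show "a \<odot>\<^bsub>?M\<^esub> (x \<oplus>\<^bsub>?M\<^esub> y) = a \<odot>\<^bsub>?M\<^esub> x \<oplus>\<^bsub>?M\<^esub> a \<odot>\<^bsub>?M\<^esub> y"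
      using * by (simp add: cech_smult cech_add lin distrib_left)
  qed
  thus ?thesis using K by (simp add: vectorspace_def)
qed

end

theory Submission
  imports Defs
begin

text \<open>Every open cover of the suspension is refined by a cover by boxes: the images of sets
  \<open>V \<times> I\<close>, where \<open>V\<close> consists of the points of the orbit closure with a given factor of length \<open>L\<close>
  in a fixed window and \<open>I\<close> is an interval of length \<open>2 / m\<close> around a multiple of \<open>1 / m\<close>. Two distinct
  boxes meet only if they are neighbours on a subdivision of the Rauzy graph, whose vertices and
  edges are the factors of length \<open>L\<close> and \<open>L + 1\<close>. Hence the 1-cocycles of such a cover modulo
  coboundaries are controlled by the cycle rank of this graph, which is at most
  \<open>p (L + 1) - p L + 1\<close>. As \<open>p\<close> grows at most linearly, this number stays below a fixed bound for
  arbitrarily large \<open>L\<close>, and so any larger family of classes is linearly dependent.\<close>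

section \<open>Words and Rauzy graphs\<close>

text \<open>Gaussian elimination, by induction on the equations: an unknown with nonzero coefficient
  in the new equation is the pivot, and eliminating it leaves one equation and one unknown
  fewer.\<close>

lemma homogeneous_system_nontrivial_solution:
  fixes a :: "'i \<Rightarrow> 'e \<Rightarrow> 'k::field"
  assumes "finite E" "finite I" "card E < card I"
  shows "\<exists>c. (\<exists>i\<in>I. c i \<noteq> 0) \<and> (\<forall>e\<in>E. (\<Sum>i\<in>I. c i * a i e) = 0)"
  using assms
proof (induction E arbitrary: I a rule: finite_induct)
  case empty
  hence "I \<noteq> {}" by auto
  thus ?case by (intro exI[of _ "\<lambda>_. 1"]) auto
next
  case (insert e E)
  show ?case
  proof (cases "\<forall>i\<in>I. a i e = 0")
    case True
    obtain c where "\<exists>i\<in>I. c i \<noteq> 0" "\<forall>e\<in>E. (\<Sum>i\<in>I. c i * a i e) = 0"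
      using insert.IH[of I a] insert.hyps insert.prems by auto
    thus ?thesis using True by (intro exI[of _ c]) auto
  next
    case False
    then obtain p where p: "p \<in> I" "a p e \<noteq> 0" by blast
    define J where "J = I - {p}"
    have I: "I = insert p J" "p \<notin> J" "finite J" using p insert.prems by (auto simp: J_def)
    \<comment> \<open>\<open>b\<close> is the system left after solving equation \<open>e\<close>
      for the pivot unknown; \<open>c'\<close> below restores that unknown.\<close>
    define b where "b i d = a i d - a i e / a p e * a p d" for i d
    have "card E < card J" using insert I by simp
    then obtain c where c: "\<exists>i\<in>J. c i \<noteq> 0" "\<forall>d\<in>E. (\<Sum>i\<in>J. c i * b i d) = 0"
      using insert.IH[of J b] I(3) by auto
    define c' where "c' = c(p := - (\<Sum>i\<in>J. c i * a i e) / a p e)"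
    have "(\<Sum>i\<in>I. c' i * a i d) = (\<Sum>i\<in>J. c i * b i d)" for d
    proof -
      have "(\<Sum>i\<in>J. c' i * a i d) = (\<Sum>i\<in>J. c i * a i d)"
        using I(2) by (intro sum.cong) (auto simp: c'_def)
      hence "(\<Sum>i\<in>I. c' i * a i d)
          = - (\<Sum>i\<in>J. c i * a i e) / a p e * a p d + (\<Sum>i\<in>J. c i * a i d)"
        using I by (simp add: c'_def)
      also have "\<dots> = (\<Sum>i\<in>J. c i * b i d)"
        by (simp add: b_def right_diff_distrib sum_subtractf sum_divide_distrib sum_distrib_right)
          (simp add: mult_ac)
      finally show ?thesis .
    qed
    moreover have "(\<Sum>i\<in>J. c i * b i e) = 0" using p by (simp add: b_def)
    moreover have "\<exists>i\<in>I. c' i \<noteq> 0" using c(1) I by (auto simp: c'_def)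
    ultimately show ?thesis using c(2) by (intro exI[of _ c']) auto
  qed
qed

text \<open>If all increments beyond \<open>N\<close> exceeded \<open>nat \<lceil>C\<rceil>\<close>,
  then \<open>p\<close> would eventually outgrow slope \<open>C\<close>. The freedom in
  \<open>N\<close> serves to meet a lower bound on the window length of the boxes.\<close>

lemma exists_small_increment:
  fixes p :: "nat \<Rightarrow> nat"
  assumes "\<forall>\<^sub>F n in sequentially. real (p n) \<le> C * real n"
  shows "\<exists>n\<ge>N. p (Suc n) \<le> p n + nat \<lceil>C\<rceil>"
proof (rule ccontr)
  assume "\<not> ?thesis"
  hence step: "p n + nat \<lceil>C\<rceil> < p (Suc n)" if "n \<ge> N" for n using that by force
  define K where "K = nat \<lceil>C\<rceil>"
  have grow: "(K + 1) * k \<le> p (N + k)" for k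
  proof (induction k)
    case (Suc k)
    thus ?case using step[of "N + k"] by (simp add: K_def)
  qed simp
  from assms obtain n0 where n0: "\<And>n. n \<ge> n0 \<Longrightarrow> real (p n) \<le> C * real n"
    by (auto simp: eventually_sequentially)
  \<comment> \<open>\<open>k \<ge> n0\<close> brings the linear bound into force, and
    \<open>k > K * N\<close> gives \<open>(K + 1) * k > K * (N + k)\<close>.\<close>
  define k where "k = n0 + K * N + 1"
  have "real (p (N + k)) \<le> C * real (N + k)" by (rule n0) (simp add: k_def)
  also have "\<dots> \<le> real K * real (N + k)"
    unfolding K_def by (intro mult_right_mono) linarith+
  finally have "p (N + k) \<le> K * (N + k)" by (simp flip: of_nat_mult of_nat_add)
  with grow[of k] show False by (simp add: k_def algebra_simps)
qed

section \<open>Factors of a word and their finiteness\<close>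

definition word :: "(int \<Rightarrow> 'a) \<Rightarrow> int \<Rightarrow> nat \<Rightarrow> 'a list" where
  "word x i n = map (\<lambda>k. x (i + int k)) [0..<n]"

lemma complexity_eq: "complexity w n = card (range (\<lambda>i. word w i n))"
  unfolding complexity_def word_def by (simp add: full_SetCompr_eq)

lemma word_eq_iff: "word x i n = word y j n \<longleftrightarrow> (\<forall>k<n. x (i + int k) = y (j + int k))"
  by (auto simp: word_def list_eq_iff_nth_eq)

lemma word_shift: "word (shift m x) i n = word x (i + m) n"
  by (simp add: word_eq_iff shift_def algebra_simps)

lemma take_word: "m \<le> n \<Longrightarrow> take m (word x i n) = word x i m"
  by (simp add: word_def take_map)

lemma tl_word: "tl (word x i (Suc n)) = word x (i + 1) n"
  by (auto simp: word_def list_eq_iff_nth_eq nth_tl algebra_simps simp del: upt_Suc)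

lemma finite_words:
  assumes "finite A" "range w \<subseteq> A"
  shows "finite (range (\<lambda>i. word w i n))"
proof (rule finite_subset)
  show "range (\<lambda>i. word w i n) \<subseteq> {xs. set xs \<subseteq> A \<and> length xs = n}"
    using subsetD[OF assms(2) rangeI] by (auto simp: word_def)
  show "finite {xs. set xs \<subseteq> A \<and> length xs = n}"
    using assms(1) by (rule finite_lists_length_eq)
qed

text \<open>The word itself is a walk that visits all vertices of the Rauzy graph, so that the only
  functions with vanishing coboundary are the constants. The unknowns of the linear system are the
  coefficients \<open>c\<close> and a potential \<open>h\<close> normalised to vanish at one vertex.\<close>

lemma rauzy_graph_relation:
  fixes G :: "'i \<Rightarrow> 'a list \<Rightarrow> 'k::field"
  assumes fin: "finite A" "range w \<subseteq> A" "finite I"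
    and card: "complexity w (Suc L) + 1 < complexity w L + card I"
  shows "\<exists>c h. (\<exists>k\<in>I. c k \<noteq> 0) \<and>
    (\<forall>i. (\<Sum>k\<in>I. c k * G k (word w i (Suc L))) = h (word w (i + 1) L) - h (word w i L))"
proof -
  define v where "v i = word w i L" for i
  define e where "e i = word w i (Suc L)" for i
  define V where "V = range v - {v 0}"
  have finV: "finite V" and finE: "finite (range e)"
    unfolding V_def v_def e_def by (simp_all add: finite_words[OF fin(1,2)])
  have "card V + 1 = complexity w L"
    unfolding V_def complexity_eq v_def
    using card_Suc_Diff1[OF finite_words[OF fin(1,2)], of "word w 0 L" L] by simp
  \<comment> \<open>One equation per edge makes \<open>complexity w (Suc L)\<close> equations,
    against \<open>card I + complexity w L - 1\<close> unknowns.\<close>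
  hence less: "card (range e) < card (I <+> V)"
    using card card_Plus[OF fin(3) finV] unfolding complexity_eq e_def by linarith
  \<comment> \<open>The column of \<open>Inl k\<close> holds the values of \<open>G k\<close>; that
    of \<open>Inr u\<close> is minus the coboundary of the indicator of the vertex \<open>u\<close>,
    as \<open>take L d\<close> and \<open>tl d\<close> are the ends of the edge
    \<open>d\<close>.\<close>
  define a where "a = case_sum G
    (\<lambda>u d. of_bool (take L d = u) - (of_bool (tl d = u) :: 'k))"
  have "\<exists>c. (\<exists>z\<in>I <+> V. c z \<noteq> 0) \<and> (\<forall>d\<in>range e. (\<Sum>z\<in>I <+> V. c z * a z d) = 0)"
    by (rule homogeneous_system_nontrivial_solution[OF finE finite_Plus[OF fin(3) finV] less])
  then obtain c where c: "\<exists>z\<in>I <+> V. c z \<noteq> 0"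
    "\<forall>d\<in>range e. (\<Sum>z\<in>I <+> V. c z * a z d) = 0"
    by (elim exE conjE)
  define h where "h u = (if u \<in> V then c (Inr u) else 0)" for u
  have ind: "(\<Sum>u\<in>V. c (Inr u) * of_bool (u' = u)) = h u'" for u'
    using finV by (simp add: h_def of_bool_def if_distrib[of "\<lambda>x. _ * x"] cong: if_cong)
  have eq: "(\<Sum>k\<in>I. c (Inl k) * G k (e i)) = h (v (i + 1)) - h (v i)" for i
  proof -
    have "0 = (\<Sum>z\<in>I <+> V. c z * a z (e i))" using c(2) by simp
    also have "\<dots> = (\<Sum>k\<in>I. c (Inl k) * G k (e i)) + (h (v i) - h (v (i + 1)))"
      using fin(3) finV unfolding ind[symmetric]
      by (simp add: sum.Plus a_def right_diff_distrib sum_subtractf e_def v_def tl_word take_word)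
    finally show ?thesis by (simp add: algebra_simps)
  qed
  \<comment> \<open>If all coefficients on \<open>I\<close> vanish, \<open>h\<close> is constant
    along the walk \<open>v\<close> and zero at \<open>v 0\<close>, hence zero, and the whole
    solution is trivial.\<close>
  moreover have "\<exists>k\<in>I. c (Inl k) \<noteq> 0"
  proof (rule ccontr)
    assume no: "\<not> ?thesis"
    hence step: "h (v (i + 1)) = h (v i)" for i using eq[of i] by simp
    have "h (v i) = h (v 0)" for i
    proof (induction i rule: int_induct[where k = 0])
      case (step2 i)
      thus ?case using step[of "i - 1"] by simp
    qed (simp_all add: step)
    moreover have "h (v 0) = 0" by (simp add: h_def V_def)
    ultimately have h0: "h (v i) = 0" for i by simp
    have "c (Inr u) = 0" if u: "u \<in> V" for u
    proof -
      obtain i where "u = v i" using u unfolding V_def by blast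
      with h0[of i] u show ?thesis by (simp add: h_def)
    qed
    with no c(1) show False by auto
  qed
  ultimately show ?thesis unfolding v_def e_def by (intro exI[of _ "c \<circ> Inl"] exI[of _ h]) auto
qed

section \<open>Box covers of the suspension\<close>

abbreviation susp_point :: "'a set \<Rightarrow> (int \<Rightarrow> 'a) \<Rightarrow> (int \<Rightarrow> 'a) \<times> real \<Rightarrow> ((int \<Rightarrow> 'a) \<times> real) set"
  where "susp_point A w p \<equiv> suspension_rel (orbit_closure A w) `` {p}"

lemma susp_point_eq_iff:
  assumes "x \<in> orbit_closure A w"
  shows "susp_point A w (x, t) = susp_point A w (y, s) \<longleftrightarrow>
    (\<exists>n. y = shift n x \<and> s = t - of_int n)"
  unfolding eq_equiv_class_iff[OF equiv_suspension_rel UNIV_I UNIV_I]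
  using suspension_rel_iff[OF shift_orbit_closure assms] by auto

lemma orbit_closure_subset: "orbit_closure A w \<subseteq> topspace (full_shift A)"
  unfolding orbit_closure_def by (rule closure_of_subset_topspace)

lemma openin_agree:
  assumes "finite J" "x \<in> topspace (full_shift A)"
  shows "openin (full_shift A) {y \<in> topspace (full_shift A). \<forall>j\<in>J. y j = x j}" (is "openin _ ?S")
proof -
  have "\<exists>U. finite {i \<in> UNIV. U i \<noteq> topspace (discrete_topology A)} \<and>
      (\<forall>i\<in>UNIV. openin (discrete_topology A) (U i)) \<and> y \<in> Pi\<^sub>E UNIV U \<and> Pi\<^sub>E UNIV U \<subseteq> ?S"
    if y: "y \<in> ?S" for y
  proof (intro exI conjI)
    let ?U = "\<lambda>i. if i \<in> J then {x i} else A"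
    show "finite {i \<in> UNIV. ?U i \<noteq> topspace (discrete_topology A)}"
      by (rule finite_subset[OF _ assms(1)]) auto
    show "\<forall>i\<in>UNIV. openin (discrete_topology A) (?U i)"
      using assms(2) by (auto simp: topspace_full_shift)
    show "y \<in> Pi\<^sub>E UNIV ?U"
      using y by (auto simp: topspace_full_shift PiE_UNIV_domain)
    show "Pi\<^sub>E UNIV ?U \<subseteq> ?S"
    proof
      fix z assume "z \<in> Pi\<^sub>E UNIV ?U"
      hence z: "z i \<in> ?U i" for i by (simp add: PiE_iff)
      have "z i = x i" if "i \<in> J" for i using z[of i] that by simp
      moreover have "z i \<in> A" for i
        using z[of i] assms(2) by (auto simp: topspace_full_shift split: if_splits)
      ultimately show "z \<in> ?S" by (auto simp: topspace_full_shift)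
    qed
  qed
  thus ?thesis
    unfolding full_shift_def openin_product_topology_alt by blast
qed

lemma openin_orbit_closure_agree:
  assumes "finite J" "x \<in> orbit_closure A w"
  shows "openin (subtopology (full_shift A) (orbit_closure A w))
    {y \<in> orbit_closure A w. \<forall>j\<in>J. y j = x j}"
  unfolding openin_subtopology
  using openin_agree[OF assms(1), of x A] assms(2) orbit_closure_subset[of A w]
  by (intro exI[of _ "{y \<in> topspace (full_shift A). \<forall>j\<in>J. y j = x j}"]) auto

lemma openin_word_cylinder:
  "openin (subtopology (full_shift A) (orbit_closure A w)) {x \<in> orbit_closure A w. word x i n = u}"
proof (subst openin_subopen, intro ballI)
  fix x assume "x \<in> {x \<in> orbit_closure A w. word x i n = u}"
  thus "\<exists>T. openin (subtopology (full_shift A) (orbit_closure A w)) T \<and> x \<in> T \<and>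
      T \<subseteq> {x \<in> orbit_closure A w. word x i n = u}"
    using openin_orbit_closure_agree[of "(\<lambda>k. i + int k) ` {..<n}" x A w]
    by (intro exI[of _ "{y \<in> orbit_closure A w. \<forall>j\<in>(\<lambda>k. i + int k) ` {..<n}. y j = x j}"])
      (auto simp: word_eq_iff)
qed

text \<open>The points agreeing with \<open>x\<close> on the window form an open neighbourhood of
  \<open>x\<close>, so some shift of \<open>w\<close> is among them.\<close>

lemma word_orbit_closure:
  assumes "x \<in> orbit_closure A w"
  obtains m where "word x i n = word w m n"
proof -
  let ?S = "{y \<in> topspace (full_shift A). \<forall>j\<in>(\<lambda>k. i + int k) ` {..<n}. y j = x j}"
  have x: "x \<in> topspace (full_shift A)" using assms orbit_closure_subset by blast
  have "openin (full_shift A) ?S" by (rule openin_agree[OF _ x]) simp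
  moreover have "x \<in> ?S" using x by simp
  moreover have "\<forall>T. x \<in> T \<and> openin (full_shift A) T \<longrightarrow> (\<exists>y. y \<in> {shift n w | n. True} \<and> y \<in> T)"
    using assms unfolding orbit_closure_def in_closure_of by (rule conjunct2)
  ultimately have "\<exists>y. y \<in> {shift n w | n. True} \<and> y \<in> ?S" by meson
  then obtain m where "shift m w \<in> ?S" by blast
  hence "word x i n = word (shift m w) i n" by (simp add: word_eq_iff)
  thus ?thesis using that by (simp add: word_shift)
qed

lemma shift_self_in_orbit_closure:
  assumes "range w \<subseteq> A"
  shows "shift n w \<in> orbit_closure A w"
proof -
  have "{shift n w | n. True} \<subseteq> topspace (full_shift A)"
    using assms by (auto simp: topspace_full_shift shift_def)
  thus ?thesis unfolding orbit_closure_def using closure_of_subset by blast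
qed

text \<open>A basic open set of the product topology restricts only finitely many coordinates, so a
  large enough symmetric window contains them all.\<close>

lemma open_orbit_closure_contains_cylinder:
  assumes "openin (subtopology (full_shift A) (orbit_closure A w)) V" "x \<in> V"
  obtains N :: nat where "{y \<in> orbit_closure A w. \<forall>i. \<bar>i\<bar> \<le> int N \<longrightarrow> y i = x i} \<subseteq> V"
proof -
  from assms(1) obtain V' where V': "openin (full_shift A) V'" "V = V' \<inter> orbit_closure A w"
    unfolding openin_subtopology by blast
  with assms(2) obtain U where U: "finite {i. U i \<noteq> A}" "x \<in> Pi\<^sub>E UNIV U" "Pi\<^sub>E UNIV U \<subseteq> V'"
    unfolding full_shift_def openin_product_topology_alt by fastforce
  define N where "N = Max (insert 0 ((\<lambda>i. nat \<bar>i\<bar>) ` {i. U i \<noteq> A}))"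
  have N: "\<bar>i\<bar> \<le> int N" if "U i \<noteq> A" for i
  proof -
    have "nat \<bar>i\<bar> \<le> N" unfolding N_def using U(1) that by (intro Max_ge) auto
    thus ?thesis by linarith
  qed
  have "y \<in> V" if y: "y \<in> orbit_closure A w" "\<forall>i. \<bar>i\<bar> \<le> int N \<longrightarrow> y i = x i" for y
  proof -
    have "y i \<in> U i" for i
    proof (cases "U i = A")
      case True
      thus ?thesis using y(1) orbit_closure_subset[of A w] by (auto simp: topspace_full_shift)
    next
      case False
      thus ?thesis using y(2) N U(2) by (auto simp: PiE_iff)
    qed
    thus ?thesis using U(3) V'(2) y(1) by (auto simp: PiE_UNIV_domain)
  qed
  thus ?thesis using that by blast
qed

text \<open>Lebesgue number lemma for the cover pulled back to the compact strip
  \<open>orbit_closure A w \<times> {0..1}\<close>. Agreement on the coordinates from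
  \<open>- M\<close> to \<open>M\<close> and a time difference below \<open>d\<close> take the place
  of metric closeness.\<close>

lemma suspension_lebesgue_number:
  assumes "finite A" and \<U>: "\<U> \<in> open_covers (suspension A w)"
  obtains M :: nat and d :: real where "d > 0"
    "\<And>x s. x \<in> orbit_closure A w \<Longrightarrow> s \<in> {0..1} \<Longrightarrow> \<exists>U\<in>\<U>. \<forall>y\<in>orbit_closure A w. \<forall>t.
       (\<forall>i. \<bar>i\<bar> \<le> int M \<longrightarrow> y i = x i) \<and> \<bar>t - s\<bar> < d \<longrightarrow> susp_point A w (y, t) \<in> U"
proof -
  let ?T = "orbit_closure A w"
  let ?X = "subtopology (full_shift A) ?T"
  let ?P = "prod_topology ?X euclideanreal"
  let ?agree = "\<lambda>N x. {y \<in> ?T. \<forall>i. \<bar>i\<bar> \<le> int N \<longrightarrow> y i = x i}"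
  have tX: "topspace ?X = ?T" using orbit_closure_subset[of A w] by auto
  have cont: "continuous_map ?P (suspension A w) (susp_point A w)"
    by (rule quotient_imp_continuous_map[OF quotient_map_suspension])
  define good where "good p N e U \<longleftrightarrow> e > 0 \<and> U \<in> \<U> \<and>
      (\<forall>y\<in>?agree N (fst p). \<forall>t. \<bar>t - snd p\<bar> < e \<longrightarrow> susp_point A w (y, t) \<in> U)" for p N e U
  have "\<exists>N e U. good p N e U"
    if "p \<in> ?T \<times> {0..1::real}" for p
  proof -
    obtain x s where p: "p = (x, s)" by (cases p)
    have xs: "(x, s) \<in> topspace ?P" using that p tX by auto
    hence "susp_point A w (x, s) \<in> \<Union>\<U>"
      using continuous_map_funspace[OF cont] \<U> by (auto simp: open_covers_def)
    then obtain U where U: "U \<in> \<U>" "susp_point A w (x, s) \<in> U" by blast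
    have "openin ?P {z \<in> topspace ?P. susp_point A w z \<in> U}" (is "openin _ ?Z")
      using \<U> U by (intro openin_continuous_map_preimage[OF cont]) (auto simp: open_covers_def)
    moreover have "(x, s) \<in> ?Z" using xs U by blast
    ultimately obtain V I where VI: "openin ?X V" "openin euclideanreal I" "x \<in> V" "s \<in> I"
      "V \<times> I \<subseteq> ?Z"
      unfolding openin_prod_topology_alt by meson
    obtain e where e: "e > 0" "ball s e \<subseteq> I" using VI(2,4) openE[of I s] by (auto simp flip: open_openin)
    obtain N where N: "?agree N x \<subseteq> V"
      using open_orbit_closure_contains_cylinder[OF VI(1,3)] .
    have "susp_point A w (y, t) \<in> U" if "y \<in> ?agree N x" "\<bar>t - s\<bar> < e" for y t
    proof -
      have "t \<in> I" using e(2) that(2) by (auto simp: dist_real_def abs_minus_commute)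
      hence "(y, t) \<in> ?Z" using VI(5) N that(1) by blast
      thus ?thesis by blast
    qed
    hence "good p N e U" using e(1) U(1) p by (simp add: good_def)
    thus ?thesis by blast
  qed
  then obtain N e U where NeU: "\<And>p. p \<in> ?T \<times> {0..1} \<Longrightarrow> good p (N p) (e p) (U p)"
    by metis
  note NeU = NeU[unfolded good_def]
  \<comment> \<open>Half of the admissible radius, so that a neighbourhood of any point of \<open>Z p\<close> with the other
    half as its radius still lies over \<open>U p\<close>.\<close>
  define Z where "Z p = ?agree (N p) (fst p) \<times> ball (snd p) (e p / 2)" for p
  have "openin ?P (Z p)" if "p \<in> ?T \<times> {0..1}" for p
  proof -
    have "finite {i. \<bar>i\<bar> \<le> int (N p)}"
      by (rule finite_subset[of _ "{- int (N p)..int (N p)}"]) auto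
    from openin_orbit_closure_agree[OF this, of "fst p" A w] that show ?thesis
      unfolding Z_def by (auto simp: openin_prod_Times_iff simp flip: open_openin)
  qed
  hence Z_open: "openin ?P W" if "W \<in> Z ` (?T \<times> {0..1})" for W using that by blast
  have Z_cover: "?T \<times> {0..1} \<subseteq> \<Union>(Z ` (?T \<times> {0..1}))"
  proof
    fix p assume p: "p \<in> ?T \<times> {0..1::real}"
    hence "p \<in> Z p" using NeU[OF p] by (simp add: Z_def mem_Times_iff)
    thus "p \<in> \<Union>(Z ` (?T \<times> {0..1}))" using p by blast
  qed
  have "compactin ?P (?T \<times> {0..1})"
  proof -
    have "compact_space (full_shift A)"
      unfolding full_shift_def compact_space_product_topology
      using assms(1) by (simp add: compact_space_discrete_topology)
    hence "compactin (full_shift A) ?T"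
      unfolding orbit_closure_def by (intro closedin_compact_space closedin_closure_of)
    thus ?thesis by (simp add: compactin_Times compactin_subtopology)
  qed
  from compactinD[OF this _ Z_cover] Z_open
  have "\<exists>F. finite F \<and> F \<subseteq> Z ` (?T \<times> {0..1}) \<and> ?T \<times> {0..1} \<subseteq> \<Union>F" .
  then obtain F where F: "finite F" "F \<subseteq> Z ` (?T \<times> {0..1})" "?T \<times> {0..1} \<subseteq> \<Union>F"
    by (elim exE conjE)
  obtain D where D: "finite D" "D \<subseteq> ?T \<times> {0..1}" "?T \<times> {0..1} \<subseteq> \<Union>(Z ` D)"
    using finite_subset_image[OF F(1,2)] F(3) by auto
  \<comment> \<open>The largest window and the smallest half radius of the finite subcover; the
    inserted \<open>0\<close> and \<open>1\<close> serve the case of an empty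
    \<open>D\<close>.\<close>
  define M where "M = Max (insert 0 (N ` D))"
  define d where "d = Min (insert 1 ((\<lambda>p. e p / 2) ` D))"
  have M: "N p \<le> M" if "p \<in> D" for p unfolding M_def using D(1) that by (intro Max_ge) auto
  have d: "d \<le> e p / 2" if "p \<in> D" for p unfolding d_def using D(1) that by (intro Min_le) auto
  have "d > 0" unfolding d_def using D(1,2) NeU by (subst Min_gr_iff) auto
  moreover have "\<exists>U\<in>\<U>. \<forall>y\<in>?T. \<forall>t. (\<forall>i. \<bar>i\<bar> \<le> int M \<longrightarrow> y i = x i) \<and> \<bar>t - s\<bar> < d \<longrightarrow>
      susp_point A w (y, t) \<in> U" if xs: "x \<in> ?T" "s \<in> {0..1}" for x s
  proof -
    obtain p where p: "p \<in> D" "(x, s) \<in> Z p" using xs D(3) by blast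
    have Up: "U p \<in> \<U>" "\<forall>y\<in>?agree (N p) (fst p). \<forall>t. \<bar>t - snd p\<bar> < e p \<longrightarrow> susp_point A w (y, t) \<in> U p"
      using NeU[of p] p(1) D(2) by auto
    have "susp_point A w (y, t) \<in> U p"
      if y: "y \<in> ?T" "\<forall>i. \<bar>i\<bar> \<le> int M \<longrightarrow> y i = x i" "\<bar>t - s\<bar> < d" for y t
    proof -
      have "y i = fst p i" if "\<bar>i\<bar> \<le> int (N p)" for i
        using that M[OF p(1)] y(2) p(2) by (auto simp: Z_def)
      hence "y \<in> ?agree (N p) (fst p)" using y(1) by simp
      moreover have "\<bar>s - snd p\<bar> < e p / 2"
        using p(2) by (auto simp: Z_def dist_real_def abs_minus_commute)
      hence "\<bar>t - snd p\<bar> < e p" using d[OF p(1)] y(3) by linarith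
      ultimately show ?thesis using Up(2) by simp
    qed
    thus ?thesis using Up(1) by blast
  qed
  ultimately show ?thesis by (rule that)
qed

section \<open>Boxes, their intersections and their indices\<close>

definition susp_box :: "'a set \<Rightarrow> (int \<Rightarrow> 'a) \<Rightarrow> nat \<Rightarrow> nat \<Rightarrow> nat \<Rightarrow> 'a list \<Rightarrow> nat \<Rightarrow> ((int \<Rightarrow> 'a) \<times> real) set set"
  where "susp_box A w M L m v j = {susp_point A w (x, t) | x t.
    x \<in> orbit_closure A w \<and> word x (- int M) L = v \<and> \<bar>t * real m - real j\<bar> < 1}"

text \<open>Positions stop at \<open>m - 1\<close> because \<open>(x, 1)\<close> and
  \<open>(shift 1 x, 0)\<close> are the same point: the next box is at position \<open>0\<close>
  over a shifted window. The window starts at \<open>- M\<close> and extends to the right, so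
  \<open>L\<close> can grow while \<open>M\<close> and \<open>m\<close> stay fixed.\<close>

definition box_cover :: "'a set \<Rightarrow> (int \<Rightarrow> 'a) \<Rightarrow> nat \<Rightarrow> nat \<Rightarrow> nat \<Rightarrow> ((int \<Rightarrow> 'a) \<times> real) set set set"
  where "box_cover A w M L m = {susp_box A w M L m v j | v j. v \<in> range (\<lambda>i. word w i L) \<and> j < m}"

lemma box_cover_open:
  assumes "m > 0"
  shows "box_cover A w M L m \<in> open_covers (suspension A w)"
proof -
  have "openin (suspension A w) (susp_box A w M L m v j)" for v j
  proof -
    have "\<bar>t * real m - real j\<bar> < 1 \<longleftrightarrow> t \<in> {(real j - 1) / real m<..<(real j + 1) / real m}" for t
      using assms by (auto simp: field_simps abs_less_iff)
    hence eq: "susp_box A w M L m v j = {susp_point A w (x, t) | x t.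
        x \<in> {x \<in> orbit_closure A w. word x (- int M) L = v} \<and>
        t \<in> {(real j - 1) / real m<..<(real j + 1) / real m}}"
      unfolding susp_box_def by blast
    show ?thesis unfolding suspension_def eq
      by (rule topology_generated_by_Basis, rule CollectI, intro exI conjI, rule refl,
          rule openin_word_cylinder)
  qed
  moreover have "c \<in> \<Union>(box_cover A w M L m)" if c: "c \<in> topspace (suspension A w)" for c
  proof -
    obtain x t where xt: "x \<in> orbit_closure A w" "c = susp_point A w (x, t)"
      using c unfolding topspace_suspension by (auto elim!: quotientE)
    \<comment> \<open>The representative with time in \<open>[0, 1)\<close> yields a position below
      \<open>m\<close>.\<close>
    define n where "n = \<lfloor>t\<rfloor>"
    define y where "y = shift n x"
    define s where "s = t - of_int n"
    define j where "j = nat \<lfloor>s * real m\<rfloor>"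
    have y: "y \<in> orbit_closure A w" unfolding y_def by (rule shift_orbit_closure[OF xt(1)])
    have s: "0 \<le> s" "s < 1" unfolding s_def n_def by linarith+
    have "0 \<le> s * real m" using s by simp
    moreover have "s * real m < real m" using s assms by simp
    ultimately have j: "j < m" "\<bar>s * real m - real j\<bar> < 1" unfolding j_def by linarith+
    have "c = susp_point A w (y, s)"
      using xt susp_point_eq_iff[OF xt(1)] by (auto simp: y_def s_def)
    hence "c \<in> susp_box A w M L m (word y (- int M) L) j"
      unfolding susp_box_def using y j by blast
    moreover obtain i where "word y (- int M) L = word w i L"
      using word_orbit_closure[OF y] .
    ultimately show ?thesis using j(1) unfolding box_cover_def by blast
  qed
  ultimately show ?thesis
    unfolding open_covers_def by (fastforce simp: box_cover_def dest: openin_subset)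
qed

text \<open>A common point has representatives differing by a shift \<open>n\<close>, and positions
  below \<open>m\<close> force \<open>n\<close> to be \<open>-1\<close>, \<open>0\<close> or
  \<open>1\<close>. For \<open>n = 0\<close> the word is the same and the positions differ by at
  most one; otherwise the boxes meet where an edge of the Rauzy graph enters its terminal
  vertex.\<close>

lemma box_meetE:
  assumes "susp_box A w M L m v j \<inter> susp_box A w M L m v' j' \<noteq> {}" "j < m" "j' < m"
  obtains "v' = v" "j' = j" | "v' = v" "j' = Suc j" | "v' = v" "j = Suc j'"
  | i where "j = m - 1" "j' = 0" "v = word w i L" "v' = word w (i + 1) L"
  | i where "j' = m - 1" "j = 0" "v' = word w i L" "v = word w (i + 1) L"
proof -
  obtain x t y s where x: "x \<in> orbit_closure A w" "word x (- int M) L = v" "\<bar>t * real m - real j\<bar> < 1"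
    and y: "y \<in> orbit_closure A w" "word y (- int M) L = v'" "\<bar>s * real m - real j'\<bar> < 1"
    and eq: "susp_point A w (x, t) = susp_point A w (y, s)"
    using assms(1) unfolding susp_box_def by auto
  obtain n where n: "y = shift n x" "s = t - of_int n"
    using eq unfolding susp_point_eq_iff[OF x(1)] by blast
  have "t * real m - s * real m = of_int n * real m" by (simp add: n algebra_simps)
  hence "\<bar>of_int n * real m - (real j - real j')\<bar> < 2" using x(3) y(3) by linarith
  hence "\<bar>real_of_int (n * int m - (int j - int j'))\<bar> < 2" by simp
  hence d: "\<bar>n * int m - (int j - int j')\<bar> < 2" by linarith
  have "n < 2"
  proof (rule ccontr)
    assume "\<not> n < 2"
    hence "2 * int m \<le> n * int m" by (intro mult_right_mono) auto
    with d assms(2,3) show False by linarith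
  qed
  moreover have "- 2 < n"
  proof (rule ccontr)
    assume "\<not> - 2 < n"
    hence "n * int m \<le> (- 2) * int m" by (intro mult_right_mono) auto
    with d assms(2,3) show False by linarith
  qed
  ultimately consider "n = 0" | "n = 1" | "n = - 1" by linarith
  thus ?thesis
  proof cases
    case 1
    have v: "v' = v" using 1 n(1) x(2) y(2) by simp
    have "j' = j \<or> j' = Suc j \<or> j = Suc j'" using d 1 by auto
    thus ?thesis using v that(1-3) by blast
  next
    case 2
    \<comment> \<open>This factor of length \<open>L + 1\<close> is the edge crossed: its first
      \<open>L\<close> letters are the word of \<open>x\<close>, its last \<open>L\<close> letters
      that of \<open>shift 1 x\<close>.\<close>
    obtain i where i: "word x (- int M) (Suc L) = word w i (Suc L)"
      using word_orbit_closure[OF x(1)] .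
    have "v = word w i L" using arg_cong[OF i, of "take L"] x(2) by (simp add: take_word)
    moreover have "v' = word w (i + 1) L"
      using arg_cong[OF i, of tl] y(2) 2 n(1) by (simp add: tl_word word_shift)
    moreover have "j = m - 1" "j' = 0" using d 2 assms(2,3) by auto
    ultimately show ?thesis by (intro that(4))
  next
    case 3
    obtain i where i: "word y (- int M) (Suc L) = word w i (Suc L)"
      using word_orbit_closure[OF y(1)] .
    have "x = shift 1 y" using 3 n(1) by simp
    hence "v = word w (i + 1) L"
      using arg_cong[OF i, of tl] x(2) by (simp add: tl_word word_shift)
    moreover have "v' = word w i L" using arg_cong[OF i, of "take L"] y(2) by (simp add: take_word)
    moreover have "j' = m - 1" "j = 0" using d 3 assms(2,3) by auto
    ultimately show ?thesis by (intro that(5))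
  qed
qed

text \<open>Allows functions of the index \<open>(v, j)\<close> to be read as functions of boxes.
  The box of a factor of \<open>w\<close> contains a point at time \<open>j / m\<close>; a
  representative of it in the other box differs by a shift \<open>n\<close> with
  \<open>j - j' = n * m\<close>, so \<open>n = 0\<close>.\<close>

lemma box_inject:
  assumes "range w \<subseteq> A" "v \<in> range (\<lambda>i. word w i L)" "j < m" "j' < m"
    and eq: "susp_box A w M L m v j = susp_box A w M L m v' j'"
  shows "v = v' \<and> j = j'"
proof -
  obtain i where i: "v = word w i L" using assms(2) by blast
  define x where "x = shift (i + int M) w"
  have x: "x \<in> orbit_closure A w" unfolding x_def by (rule shift_self_in_orbit_closure[OF assms(1)])
  have v: "word x (- int M) L = v" by (simp add: x_def word_shift i)
  have "\<bar>real j / real m * real m - real j\<bar> < 1" using assms(3) by simp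
  hence "susp_point A w (x, real j / real m) \<in> susp_box A w M L m v j"
    unfolding susp_box_def using x v by blast
  hence "susp_point A w (x, real j / real m) \<in> susp_box A w M L m v' j'" unfolding eq .
  then obtain y s where y: "word y (- int M) L = v'" "\<bar>s * real m - real j'\<bar> < 1"
    and "susp_point A w (x, real j / real m) = susp_point A w (y, s)"
    unfolding susp_box_def by (elim CollectE exE conjE) (rule that; assumption)
  then obtain n where n: "y = shift n x" "s = real j / real m - of_int n"
    unfolding susp_point_eq_iff[OF x] by blast
  have "s * real m = real j - of_int n * real m" using assms(3) by (simp add: n field_simps)
  hence "\<bar>real_of_int (int j - n * int m - int j')\<bar> < 1" using y(2) by simp
  hence eq': "int j - int j' = n * int m" by linarith
  have "n = 0"
  proof (rule ccontr)
    assume "n \<noteq> 0"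
    hence "1 * int m \<le> \<bar>n\<bar> * int m" by (intro mult_right_mono) auto
    hence "int m \<le> \<bar>int j - int j'\<bar>" by (simp add: eq' abs_mult)
    with assms(3,4) show False by linarith
  qed
  thus ?thesis using eq' n(1) y(1) v by simp
qed

section \<open>Cocycles on a box cover and their potentials\<close>

lemma cech_cocycle_1:
  assumes "f \<in> cech_cocycles 1 \<U>" "[a, b] \<in> cech_simplices 1 \<U>"
  shows "f [a, a] = 0" "f [b, a] = - f [a, b]"
proof -
  have d: "f [y, z] - f [x, z] + f [x, y] = 0" if "[x, y, z] \<in> cech_simplices 2 \<U>" for x y z
  proof -
    have "cech_diff 1 \<U> f [x, y, z] = 0" using assms(1) by (simp add: cech_cocycles_def)
    thus ?thesis using that by (simp add: cech_diff_eq face_sum_Cons numeral_2_eq_2)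
  qed
  \<comment> \<open>Simplices may repeat members, so the cocycle equation applies to these
    degenerate triples and yields both identities.\<close>
  have "[a, a, a] \<in> cech_simplices 2 \<U>" "[a, b, a] \<in> cech_simplices 2 \<U>"
    using assms(2) by (auto simp: cech_simplices_def)
  from this[THEN d] show "f [a, a] = 0" "f [b, a] = - f [a, b]" by auto
qed

text \<open>The value of a cochain along the path of boxes that follows an edge \<open>e\<close> of the Rauzy graph
  from its initial vertex \<open>take L e\<close> to its terminal vertex \<open>tl e\<close>.\<close>

definition edge_value :: "'a set \<Rightarrow> (int \<Rightarrow> 'a) \<Rightarrow> nat \<Rightarrow> nat \<Rightarrow> nat \<Rightarrow>
    (((int \<Rightarrow> 'a) \<times> real) set set list \<Rightarrow> rat) \<Rightarrow> 'a list \<Rightarrow> rat" where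
  "edge_value A w M L m f e =
    (\<Sum>j<m - 1. f [susp_box A w M L m (take L e) j, susp_box A w M L m (take L e) (Suc j)])
    + f [susp_box A w M L m (take L e) (m - 1), susp_box A w M L m (tl e) 0]"

text \<open>A potential for \<open>f\<close> starts with \<open>h v\<close> at position
  \<open>0\<close> over each vertex \<open>v\<close> and adds \<open>f\<close> along the chain of
  boxes above it. Steps inside a chain then hold by construction, and the hypothesis on
  \<open>edge_value\<close> settles the step from the end of a chain to the next vertex.\<close>

lemma box_cover_coboundary:
  assumes "range w \<subseteq> A" and m: "m > 0" and f: "f \<in> cech_cocycles 1 (box_cover A w M L m)"
    and h: "\<And>i. edge_value A w M L m f (word w i (Suc L)) = h (word w (i + 1) L) - h (word w i L)"
  shows "f \<in> cech_coboundaries 1 (box_cover A w M L m)"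
proof -
  define B where "B = susp_box A w M L m"
  let ?\<W> = "box_cover A w M L m"
  let ?I = "range (\<lambda>i. word w i L) \<times> {..<m}"
  have inj: "inj_on (case_prod B) ?I"
    unfolding inj_on_def B_def using box_inject[OF assms(1), of _ L _ m _ M] by auto
  have W: "?\<W> = case_prod B ` ?I" by (auto simp: box_cover_def B_def)
  define H where "H v j = h v + (\<Sum>i<j. f [B v i, B v (Suc i)])" for v j
  \<comment> \<open>As boxes determine their indices, inverting the indexing carries
    \<open>H\<close> over to the boxes.\<close>
  define g where "g U = case_prod H (the_inv_into ?I (case_prod B) U)" for U
  have g: "g (B v j) = H v j" if "v \<in> range (\<lambda>i. word w i L)" "j < m" for v j
    using the_inv_into_f_f[OF inj, of "(v, j)"] that by (simp add: g_def)
  have edge: "f [B v (m - 1), B v' 0] = H v' 0 - H v (m - 1)"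
    if "v = word w i L" "v' = word w (i + 1) L" for v v' i
    using h[of i] that by (simp add: edge_value_def H_def B_def take_word tl_word)
  have main: "f [a, b] = g b - g a" if s: "[a, b] \<in> cech_simplices 1 ?\<W>" for a b
  proof -
    have "a \<in> ?\<W>" "b \<in> ?\<W>" using s by (simp_all add: cech_simplices_def)
    then obtain v j v' j' where a: "a = B v j" "v \<in> range (\<lambda>i. word w i L)" "j < m"
      and b: "b = B v' j'" "v' \<in> range (\<lambda>i. word w i L)" "j' < m"
      unfolding box_cover_def B_def by blast
    have "B v j \<inter> B v' j' \<noteq> {}" using s a(1) b(1) by (simp add: cech_simplices_def)
    note cocycle = cech_cocycle_1[OF f s]
    show ?thesis
      using \<open>B v j \<inter> B v' j' \<noteq> {}\<close>[unfolded B_def] a(3) b(3)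
    proof (cases rule: box_meetE)
      case 1
      thus ?thesis using cocycle(1) a(1) b(1) by simp
    next
      case 2
      thus ?thesis using a b by (simp add: g H_def)
    next
      case 3
      hence "f [b, a] = g a - g b" using a b by (simp add: g H_def)
      thus ?thesis using cocycle(2) by simp
    next
      case (4 i)
      thus ?thesis using a b edge[of v i v'] by (simp add: g)
    next
      case (5 i)
      hence "f [b, a] = g a - g b" using a b edge[of v' i v] by (simp add: g)
      thus ?thesis using cocycle(2) by simp
    qed
  qed
  define \<kappa> where "\<kappa> s = (if s \<in> cech_simplices 0 ?\<W> then g (hd s) else 0)" for s
  have "cech_diff 0 ?\<W> \<kappa> s = f s" for s
  proof (cases "s \<in> cech_simplices 1 ?\<W>")
    case True
    then obtain a b where s: "s = [a, b]" by (auto simp: cech_simplices_def length_Suc_conv)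
    have "[a] \<in> cech_simplices 0 ?\<W>" "[b] \<in> cech_simplices 0 ?\<W>"
      using True unfolding s by (auto simp: cech_simplices_def)
    thus ?thesis using main[of a b] True unfolding s
      by (simp add: cech_diff_eq face_sum_Cons \<kappa>_def)
  next
    case False
    thus ?thesis using f by (simp add: cech_diff_eq cech_cocycles_def cech_cochains_def)
  qed
  hence "f = cech_diff 0 ?\<W> \<kappa>" by auto
  moreover have "\<kappa> \<in> cech_cochains 0 ?\<W>" by (simp add: \<kappa>_def cech_cochains_def)
  ultimately show ?thesis by (simp add: cech_coboundaries_def)
qed

lemma edge_value_sum:
  assumes "finite S"
  shows "edge_value A w M L m (\<lambda>s. \<Sum>a\<in>S. c a * f a s) e
    = (\<Sum>a\<in>S. c a * edge_value A w M L m (f a) e)"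
  unfolding edge_value_def distrib_left sum.distrib sum_distrib_left by (subst sum.swap) simp

text \<open>\<open>M\<close> and \<open>m\<close> depend only on the Lebesgue number, which leaves
  \<open>L\<close> free to be a length where the complexity grows little. A window of
  \<open>2 * M + 1\<close> or more letters contains the coordinates from \<open>- M\<close> to
  \<open>M\<close>, and \<open>1 / m < d\<close>.\<close>

lemma box_cover_refines:
  assumes "finite A" "range w \<subseteq> A" "\<U> \<in> open_covers (suspension A w)"
  obtains M m :: nat where "m > 0" "\<And>L. L \<ge> 2 * M + 1 \<Longrightarrow> \<exists>\<rho>. refines_by \<rho> (box_cover A w M L m) \<U>"
proof -
  obtain M d where "d > 0" and lebesgue:
    "\<And>x s. x \<in> orbit_closure A w \<Longrightarrow> s \<in> {0..1} \<Longrightarrow> \<exists>U\<in>\<U>. \<forall>y\<in>orbit_closure A w. \<forall>t.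
       (\<forall>i. \<bar>i\<bar> \<le> int M \<longrightarrow> y i = x i) \<and> \<bar>t - s\<bar> < d \<longrightarrow> susp_point A w (y, t) \<in> U"
    using suspension_lebesgue_number[OF assms(1,3)] by metis
  obtain k where k: "inverse (real (Suc k)) < d" using reals_Archimedean[OF \<open>d > 0\<close>] by blast
  define m where "m = Suc k"
  have "m > 0" by (simp add: m_def)
  moreover have "\<exists>\<rho>. refines_by \<rho> (box_cover A w M L m) \<U>" if L: "L \<ge> 2 * M + 1" for L
  proof -
    have "\<exists>U\<in>\<U>. W \<subseteq> U" if W: "W \<in> box_cover A w M L m" for W
    proof -
      obtain i j where ij: "W = susp_box A w M L m (word w i L) j" "j < m"
        using W by (auto simp: box_cover_def)
      \<comment> \<open>A shift of \<open>w\<close> with the given factor in the window; with time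
        \<open>j / m\<close> it is the centre around which the whole box is small.\<close>
      define x where "x = shift (i + int M) w"
      have xw: "word x (- int M) L = word w i L" by (simp add: x_def word_shift)
      have agree: "\<forall>i. \<bar>i\<bar> \<le> int M \<longrightarrow> y i = x i" if y: "word y (- int M) L = word w i L" for y
      proof (intro allI impI)
        fix i assume "\<bar>i\<bar> \<le> int M"
        hence "nat (i + int M) < L" "i = - int M + int (nat (i + int M))" using L by linarith+
        moreover have "\<forall>k<L. y (- int M + int k) = x (- int M + int k)"
          using y xw by (simp flip: word_eq_iff[of y "- int M" L x "- int M"] del: uminus_add_conv_diff)
        ultimately show "y i = x i" by metis
      qed
      have "x \<in> orbit_closure A w" "real j / real m \<in> {0..1}"
        using shift_self_in_orbit_closure[OF assms(2)] ij(2) by (auto simp: x_def)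
      from lebesgue[OF this] obtain U where U: "U \<in> \<U>"
        "\<And>y t. y \<in> orbit_closure A w \<Longrightarrow> (\<forall>i. \<bar>i\<bar> \<le> int M \<longrightarrow> y i = x i) \<Longrightarrow>
          \<bar>t - real j / real m\<bar> < d \<Longrightarrow> susp_point A w (y, t) \<in> U"
        by blast
      have "\<bar>t - real j / real m\<bar> < d" if t: "\<bar>t * real m - real j\<bar> < 1" for t
      proof -
        have "t - real j / real m = (t * real m - real j) / real m"
          using \<open>m > 0\<close> by (simp add: field_simps)
        hence "\<bar>t - real j / real m\<bar> = \<bar>t * real m - real j\<bar> / real m" by simp
        also have "\<dots> < inverse (real m)" using t \<open>m > 0\<close> by (simp add: field_simps)
        also have "\<dots> < d" using k by (simp add: m_def)
        finally show ?thesis .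
      qed
      hence "W \<subseteq> U" unfolding ij(1) susp_box_def using U(2) agree by blast
      thus ?thesis using U(1) by blast
    qed
    thus ?thesis unfolding refines_by_def by metis
  qed
  ultimately show ?thesis by (rule that)
qed

section \<open>Finite dimension\<close>

text \<open>Each further class is moved with the earlier ones to a common refinement, so that linear
  dependence can be tested on cocycles of a single cover.\<close>

lemma cech_common_cover:
  assumes "finite S" "S \<subseteq> carrier (cech_cohomology n X)"
  obtains \<U> f where "\<U> \<in> open_covers X"
    "\<And>a. a \<in> S \<Longrightarrow> f a \<in> cech_cocycles n \<U>" "\<And>a. a \<in> S \<Longrightarrow> a = cech_class n X \<U> (f a)"
proof -
  have "\<exists>\<U> f. \<U> \<in> open_covers X \<and> (\<forall>a\<in>S. f a \<in> cech_cocycles n \<U> \<and> a = cech_class n X \<U> (f a))"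
    using assms
  proof (induction S rule: finite_induct)
    case empty
    show ?case using trivial_open_cover by blast
  next
    case (insert b S)
    hence "\<exists>\<U> f. \<U> \<in> open_covers X \<and>
        (\<forall>a\<in>S. f a \<in> cech_cocycles n \<U> \<and> a = cech_class n X \<U> (f a))" by simp
    then obtain \<U> f where \<U>: "\<U> \<in> open_covers X"
      and f: "\<forall>a\<in>S. f a \<in> cech_cocycles n \<U> \<and> a = cech_class n X \<U> (f a)"
      by (elim exE conjE)
    obtain \<V> g where \<V>: "\<V> \<in> open_covers X" "g \<in> cech_cocycles n \<V>" "b = cech_class n X \<V> g"
      using insert.prems by (auto elim: cech_carrierE)
    obtain \<W> \<rho> \<sigma> where \<W>: "\<W> \<in> open_covers X" "refines_by \<rho> \<W> \<U>" "refines_by \<sigma> \<W> \<V>"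
      using open_covers_common_refinement[OF \<U> \<V>(1)] .
    define h where "h = (\<lambda>a. cech_pullback n \<W> \<rho> (f a))(b := cech_pullback n \<W> \<sigma> g)"
    have "h a \<in> cech_cocycles n \<W> \<and> a = cech_class n X \<W> (h a)" if "a \<in> insert b S" for a
    proof (cases "a = b")
      case True
      thus ?thesis unfolding h_def
        using cech_pullback_cocycle[OF \<W>(3) \<V>(2)] cech_class_refine[OF \<V>(1,2) \<W>(1,3)] \<V>(3) by simp
    next
      case False
      hence fa: "f a \<in> cech_cocycles n \<U>" "a = cech_class n X \<U> (f a)" using that f by auto
      have "h a = cech_pullback n \<W> \<rho> (f a)" using False by (simp add: h_def)
      thus ?thesis
        using cech_pullback_cocycle[OF \<W>(2) fa(1)] cech_class_refine[OF \<U> fa(1) \<W>(1,2)] fa(2) by simp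
    qed
    thus ?case using \<W>(1) by blast
  qed
  thus ?thesis using that by blast
qed

text \<open>Translates the abstract \<open>lincomb\<close> into a pointwise sum. The cocycle
  property is proved alongside because adding classes in the induction step relies on it.\<close>

lemma cech_lincomb:
  assumes "finite S" "\<U> \<in> open_covers X"
    and f: "\<And>a. a \<in> S \<Longrightarrow> f a \<in> cech_cocycles n \<U>" "\<And>a. a \<in> S \<Longrightarrow> a = cech_class n X \<U> (f a)"
  shows "(\<lambda>s. \<Sum>a\<in>S. c a * f a s) \<in> cech_cocycles n \<U> \<and>
    module.lincomb (cech_cohomology n X) c S = cech_class n X \<U> (\<lambda>s. \<Sum>a\<in>S. c a * f a s)"
proof -
  let ?M = "cech_cohomology n X"
  interpret V: vectorspace "class_ring :: rat ring" ?M by (rule vectorspace_cech_cohomology)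
  show ?thesis unfolding V.lincomb_def using assms(1) f
  proof (induction S rule: finite_induct)
    case empty
    show ?case by (simp add: cech_cocycles_linear cech_zero[OF assms(2)])
  next
    case (insert b S)
    let ?g = "\<lambda>s. \<Sum>a\<in>S. c a * f a s"
    have IH: "?g \<in> cech_cocycles n \<U>"
      "(\<Oplus>\<^bsub>?M\<^esub>a\<in>S. c a \<odot>\<^bsub>?M\<^esub> a) = cech_class n X \<U> ?g"
      using insert.IH insert.prems by auto
    have fb: "f b \<in> cech_cocycles n \<U>" "b = cech_class n X \<U> (f b)"
      using insert.prems[of b] by auto
    have car: "a \<in> carrier ?M" if "a \<in> insert b S" for a
      using insert.prems[OF that] cech_class_carrier[OF assms(2)] by metis
    have "(\<Oplus>\<^bsub>?M\<^esub>a\<in>insert b S. c a \<odot>\<^bsub>?M\<^esub> a)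
        = c b \<odot>\<^bsub>?M\<^esub> b \<oplus>\<^bsub>?M\<^esub> (\<Oplus>\<^bsub>?M\<^esub>a\<in>S. c a \<odot>\<^bsub>?M\<^esub> a)"
      using insert.hyps car by (intro V.finsum_insert) (auto intro!: V.smult_closed)
    also have "c b \<odot>\<^bsub>?M\<^esub> b = cech_class n X \<U> (\<lambda>s. c b * f b s)"
      using cech_smult[OF assms(2) fb(1), of "c b"] fb(2) by simp
    also have "\<dots> \<oplus>\<^bsub>?M\<^esub> (\<Oplus>\<^bsub>?M\<^esub>a\<in>S. c a \<odot>\<^bsub>?M\<^esub> a)
        = cech_class n X \<U> (\<lambda>s. c b * f b s + ?g s)"
      unfolding IH(2) by (rule cech_add[OF assms(2) cech_cocycles_linear(2)[OF fb(1)] IH(1)])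
    finally have "(\<Oplus>\<^bsub>?M\<^esub>a\<in>insert b S. c a \<odot>\<^bsub>?M\<^esub> a)
        = cech_class n X \<U> (\<lambda>s. c b * f b s + ?g s)" .
    moreover have "(\<lambda>s. c b * f b s + ?g s) \<in> cech_cocycles n \<U>"
      by (intro cech_cocycles_linear fb IH)
    ultimately show ?case using insert.hyps by simp
  qed
qed

lemma cech_class_coboundary:
  assumes "\<U> \<in> open_covers X" "f \<in> cech_cocycles n \<U>" "f \<in> cech_coboundaries n \<U>"
  shows "cech_class n X \<U> f = \<zero>\<^bsub>cech_cohomology n X\<^esub>"
  unfolding cech_zero[OF assms(1)]
proof (rule cech_class_eqI, rule cech_relI[OF _ _ assms(1) refines_by_id refines_by_id])
  have "f \<in> cech_cochains n \<U>" using assms(2) by (simp add: cech_cocycles_def)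
  thus "(\<lambda>s. cech_pullback n \<U> (\<lambda>x. x) f s - cech_pullback n \<U> (\<lambda>x. x) (\<lambda>s. 0) s)
      \<in> cech_coboundaries n \<U>"
    using assms(3) by (simp add: cech_pullback_id cech_pullback_linear)
qed (use assms in \<open>auto simp: cech_reps_def cech_cocycles_linear\<close>)

text \<open>An infinite independent set would have an independent subset of \<open>N + 1\<close>
  elements. With sizes bounded, some independent set is maximal under inclusion, and such a set
  generates.\<close>

lemma (in vectorspace) fin_dim_if_li_bounded:
  assumes "\<And>S. S \<subseteq> carrier V \<Longrightarrow> finite S \<Longrightarrow> lin_indpt S \<Longrightarrow> card S \<le> N"
  shows fin_dim
proof -
  have "finite S \<and> card S \<le> N" if S: "S \<subseteq> carrier V \<and> lin_indpt S" for S
  proof -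
    have "finite S"
    proof (rule ccontr)
      assume "infinite S"
      then obtain T where T: "T \<subseteq> S" "finite T" "card T = Suc N"
        by (metis infinite_arbitrarily_large)
      hence "lin_indpt T" using S subset_li_is_li by blast
      with assms[of T] T S show False by auto
    qed
    thus ?thesis using assms S by blast
  qed
  moreover have "{} \<subseteq> carrier V \<and> lin_indpt {}" by (auto simp: lin_dep_def)
  ultimately obtain S where S: "finite S" "maximal S (\<lambda>S. S \<subseteq> carrier V \<and> lin_indpt S)"
    using maximal_exists[of "\<lambda>S. S \<subseteq> carrier V \<and> lin_indpt S" N "{}"] by blast
  show ?thesis
    unfolding fin_dim_def using S(1) max_li_is_gen[OF S(2)] S(2) unfolding maximal_def by blast
qed

theorem proposition5p16:
  fixes A :: "'a set" and w :: "int \<Rightarrow> 'a" and C :: real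
  assumes "finite A"
    and "range w \<subseteq> A"
    and "\<forall>\<^sub>F n in sequentially. real (complexity w n) \<le> C * real n"
  shows "vectorspace.fin_dim (class_ring :: rat ring) (cech_cohomology 1 (suspension A w))"
proof -
  let ?X = "suspension A w"
  let ?M = "cech_cohomology 1 ?X"
  \<comment> \<open>Bounds \<open>complexity w (Suc L) - complexity w L + 1\<close> at every
    \<open>L\<close> with an increment of at most \<open>nat \<lceil>C\<rceil>\<close>.\<close>
  define N where "N = nat \<lceil>C\<rceil> + 1"
  interpret V: vectorspace "class_ring :: rat ring" ?M by (rule vectorspace_cech_cohomology)
  show ?thesis
  proof (rule V.fin_dim_if_li_bounded)
    fix S assume S: "S \<subseteq> carrier ?M" "finite S" "V.lin_indpt S"
    show "card S \<le> N"
    proof (rule ccontr)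
      assume "\<not> card S \<le> N"
      obtain \<U> f where \<U>: "\<U> \<in> open_covers ?X" and f: "\<And>a. a \<in> S \<Longrightarrow> f a \<in> cech_cocycles 1 \<U>"
        "\<And>a. a \<in> S \<Longrightarrow> a = cech_class 1 ?X \<U> (f a)"
        using cech_common_cover[OF S(2,1)] by blast
      obtain M m where m: "m > 0"
        and refine: "\<And>L. L \<ge> 2 * M + 1 \<Longrightarrow> \<exists>\<rho>. refines_by \<rho> (box_cover A w M L m) \<U>"
        by (rule box_cover_refines[OF assms(1,2) \<U>]) (rule that; assumption)
      \<comment> \<open>Only now, with \<open>M\<close> and \<open>m\<close> fixed, is the length
        chosen.\<close>
      obtain L where L: "L \<ge> 2 * M + 1" "complexity w (Suc L) \<le> complexity w L + nat \<lceil>C\<rceil>"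
        using exists_small_increment[OF assms(3), of "2 * M + 1"] by blast
      define \<W> where "\<W> = box_cover A w M L m"
      have \<W>: "\<W> \<in> open_covers ?X" unfolding \<W>_def by (rule box_cover_open[OF m])
      obtain \<rho> where \<rho>: "refines_by \<rho> \<W> \<U>" using refine[OF L(1)] unfolding \<W>_def by blast
      define g where "g a = cech_pullback 1 \<W> \<rho> (f a)" for a
      have g: "g a \<in> cech_cocycles 1 \<W>" "a = cech_class 1 ?X \<W> (g a)" if "a \<in> S" for a
        unfolding g_def using cech_pullback_cocycle[OF \<rho> f(1)[OF that]]
          cech_class_refine[OF \<U> f(1)[OF that] \<W> \<rho>] f(2)[OF that] by auto
      \<comment> \<open>The small increment at \<open>L\<close> and \<open>card S > N\<close>
        together leave more unknowns than equations.\<close>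
      have "complexity w (Suc L) + 1 < complexity w L + card S"
        using L(2) \<open>\<not> card S \<le> N\<close> by (simp add: N_def)
      from rauzy_graph_relation[OF assms(1,2) S(2) this, of "\<lambda>a. edge_value A w M L m (g a)"]
      obtain c h where c: "\<exists>a\<in>S. c a \<noteq> 0"
        and h: "\<And>i. (\<Sum>a\<in>S. c a * edge_value A w M L m (g a) (word w i (Suc L)))
          = h (word w (i + 1) L) - h (word w i L)"
        by blast
      define F where "F s = (\<Sum>a\<in>S. c a * g a s)" for s
      have F: "F \<in> cech_cocycles 1 \<W>" "V.lincomb c S = cech_class 1 ?X \<W> F"
        using cech_lincomb[OF S(2) \<W> g, of c] unfolding F_def by auto
      \<comment> \<open>By linearity the edge values of \<open>F\<close> are the differences of
        \<open>h\<close> along edges, so the class of \<open>F\<close> vanishes although some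
        \<open>c a\<close> does not.\<close>
      have "F \<in> cech_coboundaries 1 \<W>"
        using F(1) unfolding \<W>_def
        by (rule box_cover_coboundary[OF assms(2) m, where h = h])
          (simp add: F_def[abs_def] edge_value_sum[OF S(2)] h)
      with F have "V.lincomb c S = \<zero>\<^bsub>?M\<^esub>" using cech_class_coboundary[OF \<W>] by simp
      moreover obtain a where "a \<in> S" "c a \<noteq> 0" using c by blast
      ultimately have "V.lin_dep S" using S(2) by (intro V.lin_dep_crit[where a = c]) auto
      with S(3) show False by blast
    qed
  qed
qed

end
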